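(* Let $M$ be a positive integer. There is an algorithm that, for a given triple $(T,w,\epsilon)$, where $\epsilon$ is a positive real, $T$ is a tree of order $n$, and $w:V(T)\to \mathbb{Z}_{\geq 0}$ is a function such that (i) $\epsilon\leq \min\{\frac{1}{3},\frac{1}{M}\}$ and (ii) $\max\{ w(u):u\in V(T)\}\leq M \min\{ w(u):u\in V(T)\}$, determines a connected $w$-safe set $S$ in $T$ with $w(S)\leq (1+3\epsilon+2\epsilon^2)\cdot cs(T,w)+w_{\max}$, where $w_{\max}=\max\{w(u):u\in V(T)\}$, in $O\left(\frac{(1+3\epsilon+M)^4n^5}{\epsilon^8}\right)$ time.
   Context: For a graph $G$, a weight function $w:V(G)\to\mathbb{Z}_{\geq 0}$, a set $U\subseteq V(G)$ and a subgraph $H$ of $G$, let $w(U)=\sum_{u\in U}w(u)$ and $w(H)=w(V(H))$. Two disjoint subgraphs $C,D$ of $G$ are adjacent if some vertex of $C$ is adjacent to some vertex of $D$. A set $S\subseteq V(G)$ is $w$-safe if $w(C)\geq w(D)$ for every component $C$ of the induced subgraph $G[S]$ and every component $D$ of $G-S$ such that $D$ is adjacent to $C$. A set $S$ is connected if $G[S]$ is connected. The connected safe number $cs(G,w)$ is the minimum of $w(S)$ over all connected $w$-safe sets $S$ in $G$. *)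

theory Defs
  imports Complex_Main "Graph_Theory.Graph_Theory"
begin

section \<open>Connected safe sets\<close>

text \<open>
  Undirected simple graphs are symmetric loop-free digraphs without parallel arcs (locale
  \<open>graph\<close>), an edge being a pair of opposite arcs.  The predicate \<open>tree\<close> of the library cannot be
  used: it forbids directed cycles, and every edge of a symmetric digraph is a directed cycle of
  length two.
\<close>

definition undirected_tree :: "('a, 'b) pre_digraph \<Rightarrow> bool" where
  "undirected_tree G \<longleftrightarrow> graph G \<and> Digraph_Component.connected G
     \<and> \<not> (\<exists>p. pre_digraph.cycle G p \<and> 3 \<le> length p)"

definition weight :: "('a \<Rightarrow> nat) \<Rightarrow> 'a set \<Rightarrow> nat" where
  "weight w U = (\<Sum>u\<in>U. w u)"

text \<open>In a symmetric digraph the components are the strongly connected components.\<close>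

definition components :: "('a, 'b) pre_digraph \<Rightarrow> ('a, 'b) pre_digraph set" where
  "components G = pre_digraph.sccs G"

definition adjacent_in ::
  "('a, 'b) pre_digraph \<Rightarrow> ('a, 'b) pre_digraph \<Rightarrow> ('a, 'b) pre_digraph \<Rightarrow> bool" where
  "adjacent_in G C D \<longleftrightarrow> (\<exists>u\<in>verts C. \<exists>v\<in>verts D. u \<rightarrow>\<^bsub>G\<^esub> v)"

definition w_safe :: "('a, 'b) pre_digraph \<Rightarrow> ('a \<Rightarrow> nat) \<Rightarrow> 'a set \<Rightarrow> bool" where
  "w_safe G w S \<longleftrightarrow> S \<subseteq> verts G \<and>
     (\<forall>C\<in>components (G \<restriction> S). \<forall>D\<in>components (G \<restriction> (verts G - S)).
        adjacent_in G C D \<longrightarrow> weight w (verts C) \<ge> weight w (verts D))"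

text \<open>
  The library's notion of connectedness excludes the graph without vertices, so connected sets are
  nonempty.  Otherwise the empty set would be connected and safe, and \<open>cs\<close> would be constantly 0.
\<close>

definition connected_set :: "('a, 'b) pre_digraph \<Rightarrow> 'a set \<Rightarrow> bool" where
  "connected_set G S \<longleftrightarrow> S \<subseteq> verts G \<and> Digraph_Component.connected (G \<restriction> S)"

definition cs :: "('a, 'b) pre_digraph \<Rightarrow> ('a \<Rightarrow> nat) \<Rightarrow> nat" where
  "cs G w = Min {weight w S |S. connected_set G S \<and> w_safe G w S}"


section \<open>Algorithms and running time\<close>

text \<open>
  Algorithms are programs for a real random access machine with unit-cost operations.  The machine
  has an unbounded memory of natural numbers, used for indices and counters, and an unbounded
  memory of real numbers; both are addressed by natural numbers, so that indirect addressing is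
  available.

  To prevent the unit-cost measure from being exploited, natural numbers can only be added and
  subtracted (a number computed in \<open>t\<close> steps has \<open>O(t)\<close> bits more than the input), reals can
  be combined by the field operations and compared but not rounded, and the only literals in a
  program are natural numbers.
\<close>

datatype nexp =
    NLit nat
  | NCell nexp
  | NPlus nexp nexp
  | NMinus nexp nexp

datatype rexp =
    RNat nexp
  | RCell nexp
  | RPlus rexp rexp
  | RMinus rexp rexp
  | RTimes rexp rexp
  | RDivide rexp rexp

datatype bexp =
    NLess nexp nexp
  | RLess rexp rexp
  | BNot bexp
  | BAnd bexp bexp

datatype com =
    Skip
  | NStore nexp nexp
  | RStore nexp rexp
  | Seq com com
  | Cond bexp com com
  | While bexp com

type_synonym state = "(nat \<Rightarrow> nat) \<times> (nat \<Rightarrow> real)"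

primrec nval :: "nexp \<Rightarrow> state \<Rightarrow> nat" where
  "nval (NLit k) s = k"
| "nval (NCell a) s = fst s (nval a s)"
| "nval (NPlus a b) s = nval a s + nval b s"
| "nval (NMinus a b) s = nval a s - nval b s"

primrec rval :: "rexp \<Rightarrow> state \<Rightarrow> real" where
  "rval (RNat a) s = real (nval a s)"
| "rval (RCell a) s = snd s (nval a s)"
| "rval (RPlus x y) s = rval x s + rval y s"
| "rval (RMinus x y) s = rval x s - rval y s"
| "rval (RTimes x y) s = rval x s * rval y s"
| "rval (RDivide x y) s = rval x s / rval y s"

primrec bval :: "bexp \<Rightarrow> state \<Rightarrow> bool" where
  "bval (NLess a b) s \<longleftrightarrow> nval a s < nval b s"
| "bval (RLess x y) s \<longleftrightarrow> rval x s < rval y s"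
| "bval (BNot b) s \<longleftrightarrow> \<not> bval b s"
| "bval (BAnd b c) s \<longleftrightarrow> bval b s \<and> bval c s"

text \<open>The cost of evaluating an expression is the number of operations in it.\<close>

primrec ncost :: "nexp \<Rightarrow> nat" where
  "ncost (NLit k) = 1"
| "ncost (NCell a) = 1 + ncost a"
| "ncost (NPlus a b) = 1 + ncost a + ncost b"
| "ncost (NMinus a b) = 1 + ncost a + ncost b"

primrec rcost :: "rexp \<Rightarrow> nat" where
  "rcost (RNat a) = 1 + ncost a"
| "rcost (RCell a) = 1 + ncost a"
| "rcost (RPlus x y) = 1 + rcost x + rcost y"
| "rcost (RMinus x y) = 1 + rcost x + rcost y"
| "rcost (RTimes x y) = 1 + rcost x + rcost y"
| "rcost (RDivide x y) = 1 + rcost x + rcost y"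

primrec bcost :: "bexp \<Rightarrow> nat" where
  "bcost (NLess a b) = 1 + ncost a + ncost b"
| "bcost (RLess x y) = 1 + rcost x + rcost y"
| "bcost (BNot b) = 1 + bcost b"
| "bcost (BAnd b c) = 1 + bcost b + bcost c"

text \<open>\<open>exec P s t s'\<close>: started in \<open>s\<close>, the program \<open>P\<close> halts after time \<open>t\<close> in \<open>s'\<close>.\<close>

inductive exec :: "com \<Rightarrow> state \<Rightarrow> nat \<Rightarrow> state \<Rightarrow> bool" where
  Skip: "exec Skip s 1 s"
| NStore: "exec (NStore a e) s (1 + ncost a + ncost e) ((fst s)(nval a s := nval e s), snd s)"
| RStore: "exec (RStore a x) s (1 + ncost a + rcost x) (fst s, (snd s)(nval a s := rval x s))"
| Seq: "exec P s t s' \<Longrightarrow> exec Q s' u s'' \<Longrightarrow> exec (Seq P Q) s (t + u) s''"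
| CondTrue: "bval b s \<Longrightarrow> exec P s t s' \<Longrightarrow> exec (Cond b P Q) s (1 + bcost b + t) s'"
| CondFalse: "\<not> bval b s \<Longrightarrow> exec Q s t s' \<Longrightarrow> exec (Cond b P Q) s (1 + bcost b + t) s'"
| WhileFalse: "\<not> bval b s \<Longrightarrow> exec (While b P) s (1 + bcost b) s"
| WhileTrue: "bval b s \<Longrightarrow> exec P s t s' \<Longrightarrow> exec (While b P) s' u s''
    \<Longrightarrow> exec (While b P) s (1 + bcost b + t + u) s''"

inductive_cases exec_SkipE: "exec Skip s t s'"
inductive_cases exec_NStoreE: "exec (NStore a e) s t s'"
inductive_cases exec_RStoreE: "exec (RStore a x) s t s'"
inductive_cases exec_SeqE: "exec (Seq P Q) s t s'"
inductive_cases exec_CondE: "exec (Cond b P Q) s t s'"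
inductive_cases exec_WhileE: "exec (While b P) s t s'"

lemma exec_deterministic:
  "exec P s t s' \<Longrightarrow> exec P s u s'' \<Longrightarrow> u = t \<and> s'' = s'"
proof (induction arbitrary: u s'' rule: exec.induct)
  case (Skip s)
  then show ?case by (rule exec_SkipE) simp
next
  case (NStore a e s)
  then show ?case by (rule exec_NStoreE) simp
next
  case (RStore a x s)
  then show ?case by (rule exec_RStoreE) simp
next
  case (Seq P s t s' Q v r)
  from Seq.prems obtain t1 s1 u1
    where *: "exec P s t1 s1" "exec Q s1 u1 s''" "u = t1 + u1"
    by (rule exec_SeqE)
  from Seq.IH(1)[OF *(1)] have "t1 = t" "s1 = s'" by simp_all
  with * Seq.IH(2)[of u1 s''] show ?case by simp
next
  case (CondTrue b s P t s' Q)
  from CondTrue.prems obtain t1 where *: "exec P s t1 s''" "u = 1 + bcost b + t1"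
    by (rule exec_CondE) (simp_all add: CondTrue.hyps)
  from CondTrue.IH[OF *(1)] *(2) show ?case by simp
next
  case (CondFalse b s Q t s' P)
  from CondFalse.prems obtain t1 where *: "exec Q s t1 s''" "u = 1 + bcost b + t1"
    by (rule exec_CondE) (simp_all add: CondFalse.hyps)
  from CondFalse.IH[OF *(1)] *(2) show ?case by simp
next
  case (WhileFalse b s P)
  from WhileFalse.prems show ?case by (rule exec_WhileE) (simp_all add: WhileFalse.hyps)
next
  case (WhileTrue b s P t s' v r)
  from WhileTrue.prems obtain t1 s1 u1
    where *: "exec P s t1 s1" "exec (While b P) s1 u1 s''" "u = 1 + bcost b + t1 + u1"
    by (rule exec_WhileE) (simp_all add: WhileTrue.hyps)
  from WhileTrue.IH(1)[OF *(1)] have "t1 = t" "s1 = s'" by simp_all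
  with * WhileTrue.IH(2)[of u1 s''] show ?case by simp
qed


section \<open>Encoding of instances and solutions\<close>

text \<open>\<open>es\<close> lists every edge of \<open>G\<close> exactly once, in one of its two orientations.\<close>

definition edge_list :: "'a pair_pre_digraph \<Rightarrow> ('a \<times> 'a) list \<Rightarrow> bool" where
  "edge_list G es \<longleftrightarrow> distinct es \<and> set es \<inter> (set es)\<inverse> = {} \<and> parcs G = set es \<union> (set es)\<inverse>"

definition load :: "'a::zero list \<Rightarrow> nat \<Rightarrow> 'a" where
  "load xs i = (if i < length xs then xs ! i else 0)"

text \<open>
  For a graph with vertex set \<open>{..<n}\<close>, the memory of naturals initially holds \<open>n\<close> and the ends of
  the edges, the memory of reals holds \<open>\<epsilon>\<close> and the vertex weights, and all other cells are 0.
  The result is the characteristic vector in the first \<open>n\<close> cells of the memory of naturals.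
\<close>

definition input_state :: "nat \<Rightarrow> (nat \<times> nat) list \<Rightarrow> (nat \<Rightarrow> nat) \<Rightarrow> real \<Rightarrow> state" where
  "input_state n es w \<epsilon> =
     (load (n # concat (map (\<lambda>(u, v). [u, v]) es)), load (\<epsilon> # map (\<lambda>v. real (w v)) [0..<n]))"

definition output_set :: "nat \<Rightarrow> state \<Rightarrow> nat set" where
  "output_set n s = {v. v < n \<and> fst s v \<noteq> 0}"

end

theory Submission
  imports Defs
begin

text \<open>
  Fix a vertex \<open>a\<close> and grow \<open>X = {a}\<close> as long as some component of \<open>T - X\<close> is heavier than \<open>X\<close>, by adding
  the neighbour of \<open>X\<close> in a heaviest component.  Let \<open>S\<close> be any connected safe set containing \<open>a\<close>.
  As long as only vertices of \<open>S\<close> are added, \<open>w(X) \<le> w(S)\<close>.  When a vertex outside \<open>S\<close> is added for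
  the first time, its component does not meet \<open>S\<close>, because \<open>T\<close> is a tree, and hence is part of a
  component of \<open>T - S\<close>.  So from then on all components of \<open>T - X\<close> weigh at most \<open>w(S)\<close>, and \<open>X\<close> is extended
  only while \<open>w(X) < w(S)\<close>.  Either way the final safe set has weight at most \<open>w(S) + w\<^sub>m\<^sub>a\<^sub>x\<close>, and a
  lightest result over all \<open>a\<close> has weight at most \<open>cs(T, w) + w\<^sub>m\<^sub>a\<^sub>x\<close>.  With components computed by
  merging labels along the edges this takes time \<open>O(n\<^sup>4)\<close>.
\<close>

section \<open>Connectedness in terms of the arc relation\<close>

text \<open>The closure is reflexive on the whole type, so a point outside \<open>X\<close> is
  linked to itself only. This lets label classes be described without mentioning the vertex
  set.\<close>

definition linked :: "'a rel \<Rightarrow> 'a set \<Rightarrow> 'a rel" where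
  "linked A X = (Restr A X)\<^sup>*"

definition linked_set :: "'a rel \<Rightarrow> 'a set \<Rightarrow> bool" where
  "linked_set A X \<longleftrightarrow> X \<noteq> {} \<and> (\<forall>x\<in>X. \<forall>y\<in>X. (x, y) \<in> linked A X)"

lemma linked_refl [simp]: "(x, x) \<in> linked A X"
  by (simp add: linked_def)

lemma linked_trans: "(x, y) \<in> linked A X \<Longrightarrow> (y, z) \<in> linked A X \<Longrightarrow> (x, z) \<in> linked A X"
  by (auto simp: linked_def)

lemma linked_arc: "(x, y) \<in> A \<Longrightarrow> x \<in> X \<Longrightarrow> y \<in> X \<Longrightarrow> (x, y) \<in> linked A X"
  by (auto simp: linked_def)

lemma linked_sym: "sym A \<Longrightarrow> (x, y) \<in> linked A X \<Longrightarrow> (y, x) \<in> linked A X"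
  unfolding linked_def by (rule symD[OF sym_rtrancl]) (auto simp: sym_def)

lemma linked_mono: "X \<subseteq> Y \<Longrightarrow> linked A X \<subseteq> linked A Y"
  unfolding linked_def by (rule rtrancl_mono) auto

lemma linked_in: "(x, y) \<in> linked A X \<Longrightarrow> x \<in> X \<Longrightarrow> y \<in> X"
  unfolding linked_def by (induction rule: rtrancl_induct) auto

text \<open>Every vertex passed on the way from \<open>x\<close> is itself linked to
  \<open>x\<close>, so the path never leaves the class. Hence classes can be compared between
  different ambient sets.\<close>

lemma linked_in_class:
  assumes "(x, y) \<in> linked A X"
  shows "(x, y) \<in> linked A (linked A X `` {x})"
  using assms unfolding linked_def
proof (induction rule: rtrancl_induct)
  case (step y z)
  then have "(y, z) \<in> Restr A ((Restr A X)\<^sup>* `` {x})"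
    by (auto intro: rtrancl_into_rtrancl)
  with step.IH show ?case by (rule rtrancl_into_rtrancl)
qed simp

lemma linked_class_self [simp]: "x \<in> linked A X `` {x}"
  by simp

lemma linked_class_eq:
  assumes "sym A" "(x, y) \<in> linked A X"
  shows "linked A X `` {y} = linked A X `` {x}"
  using assms(2) linked_sym[OF assms] by (auto intro: linked_trans)

lemma linked_set_class:
  assumes "sym A"
  shows "linked_set A (linked A X `` {x})"
proof -
  have "linked A X `` {x} \<noteq> {}" using linked_class_self by fast
  then show ?thesis unfolding linked_set_def
    by (auto intro: linked_trans[OF linked_sym[OF assms linked_in_class] linked_in_class])
qed

lemma linked_set_insert:
  assumes "sym A" "linked_set A X" "(a, b) \<in> A" "a \<in> X"
  shows "linked_set A (insert b X)"
proof -
  have "(x, y) \<in> linked A (insert b X)" if "x \<in> X" "y \<in> X" for x y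
    using that assms(2) linked_mono[of X "insert b X" A] by (auto simp: linked_set_def)
  moreover have "(a, b) \<in> linked A (insert b X)" "(b, a) \<in> linked A (insert b X)"
    using assms by (auto intro!: linked_arc dest: symD)
  ultimately have *: "(x, a) \<in> linked A (insert b X)" "(a, x) \<in> linked A (insert b X)"
    if "x \<in> insert b X" for x using that \<open>a \<in> X\<close> by auto
  then show ?thesis unfolding linked_set_def by (auto intro: linked_trans)
qed

section \<open>Digraph connectedness and components expressed by linked classes\<close>

lemma reachable_induce_subgraph_iff:
  "x \<rightarrow>\<^sup>*\<^bsub>with_proj T \<restriction> X\<^esub> y \<longleftrightarrow> x \<in> X \<and> (x, y) \<in> linked (parcs T) X"
proof -
  have ends: "arcs_ends (with_proj T \<restriction> X) = Restr (parcs T) X"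
    by (auto simp: arcs_ends_conv)
  have "(x, y) \<in> rtrancl_on X (Restr (parcs T) X)" if "(x, y) \<in> (Restr (parcs T) X)\<^sup>*" "x \<in> X"
    using that by (induction rule: rtrancl_induct) (auto intro: rtrancl_on.rtrancl_on_into_rtrancl_on)
  then show ?thesis
    unfolding reachable_def ends linked_def induce_subgraph_verts
    using rtrancl_on_rtranclI[of x y X] in_rtrancl_on_in_F[of x y X] by auto
qed

lemma symmetric_induce_subgraph:
  "sym (parcs T) \<Longrightarrow> symmetric (with_proj T \<restriction> X)"
  by (auto simp: symmetric_def arcs_ends_conv sym_def)

context pair_graph begin

lemma sym_parcs: "sym (parcs G)"
  by (auto intro: symI arcs_symmetric)

text \<open>Connectedness is strong connectedness of the symmetric closure, and an already symmetric
  arc set equals its closure.\<close>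

lemma connected_induce_subgraph_iff:
  "Digraph_Component.connected (with_proj G \<restriction> X) \<longleftrightarrow> linked_set (parcs G) X"
proof -
  have "sym (arcs_ends (with_proj G \<restriction> X))"
    using symmetric_induce_subgraph[OF sym_parcs] by (simp add: symmetric_def)
  then have "(arcs_ends (with_proj G \<restriction> X))\<^sup>s = arcs_ends (with_proj G \<restriction> X)"
    by (auto simp: symcl_def dest: symD)
  then have "Digraph_Component.connected (with_proj G \<restriction> X) \<longleftrightarrow> strongly_connected (with_proj G \<restriction> X)"
    by (simp add: connected_conv strongly_connected_def reachable_def)
  then show ?thesis
    by (auto simp: strongly_connected_def reachable_induce_subgraph_iff linked_set_def)
qed

lemma connected_set_iff: "connected_set G X \<longleftrightarrow> X \<subseteq> pverts G \<and> linked_set (parcs G) X"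
  by (simp add: connected_set_def connected_induce_subgraph_iff)

text \<open>Strong components are the maximal sets of mutually reachable vertices; by symmetry of
  \<open>linked\<close> these are its classes.\<close>

lemma verts_components_induce:
  "verts ` components (with_proj G \<restriction> X) = (\<lambda>x. linked (parcs G) X `` {x}) ` X"
proof -
  interpret H: wf_digraph "with_proj G \<restriction> X" by (rule wellformed_induce_subgraph)
  note ls = linked_sym[OF sym_parcs] and lt = linked_trans
  have "C \<in> H.sccs_verts \<longleftrightarrow> C \<in> (\<lambda>x. linked (parcs G) X `` {x}) ` X" for C
  proof
    assume "C \<in> H.sccs_verts"
    then have ne: "C \<noteq> {}" and in_C: "\<And>u v. u \<in> C \<Longrightarrow> v \<in> C \<Longrightarrow> u \<in> X \<and> (u, v) \<in> linked (parcs G) X"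
      and out: "\<And>u v. u \<in> C \<Longrightarrow> v \<notin> C \<Longrightarrow> \<not> (u \<in> X \<and> (u, v) \<in> linked (parcs G) X)
         \<or> \<not> (v \<in> X \<and> (v, u) \<in> linked (parcs G) X)"
      by (auto simp: H.in_sccs_verts_conv_reachable reachable_induce_subgraph_iff)
    from ne obtain x where x: "x \<in> C" by auto
    then have "x \<in> X" using in_C by blast
    moreover have "C = linked (parcs G) X `` {x}"
      using in_C out x ls linked_in[of x _ "parcs G" X] by blast
    ultimately show "C \<in> (\<lambda>x. linked (parcs G) X `` {x}) ` X" by blast
  next
    assume "C \<in> (\<lambda>x. linked (parcs G) X `` {x}) ` X"
    then obtain x where x: "x \<in> X" and C: "C = linked (parcs G) X `` {x}" by blast
    show "C \<in> H.sccs_verts"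
      unfolding H.in_sccs_verts_conv_reachable reachable_induce_subgraph_iff
    proof (intro conjI ballI allI impI)
      show "C \<noteq> {}" using C linked_class_self by fast
      show "u \<in> X" if "u \<in> C" for u using that x C linked_in by fastforce
      show "(u, v) \<in> linked (parcs G) X" if "u \<in> C" "v \<in> C" for u v
      proof -
        from that have "(x, u) \<in> linked (parcs G) X" "(x, v) \<in> linked (parcs G) X" by (auto simp: C)
        then show ?thesis by (rule lt[OF ls])
      qed
      show "\<not> (u \<in> X \<and> (u, v) \<in> linked (parcs G) X) \<or> \<not> (v \<in> X \<and> (v, u) \<in> linked (parcs G) X)"
        if "u \<in> C" "v \<notin> C" for u v
      proof -
        from that have "(x, u) \<in> linked (parcs G) X" "(x, v) \<notin> linked (parcs G) X" by (auto simp: C)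
        then show ?thesis using lt[of x u "parcs G" X v] by blast
      qed
    qed
  qed
  then show ?thesis unfolding components_def H.sccs_verts_conv[symmetric] by blast
qed

text \<open>A linked \<open>S\<close> is the only component of its induced subgraph, and a component
  of the complement adjacent to \<open>S\<close> is the class of any end \<open>b\<close> of an arc
  from \<open>S\<close> into it.\<close>

lemma w_safe_iff:
  assumes "linked_set (parcs G) S" "S \<subseteq> pverts G"
  shows "w_safe G w S \<longleftrightarrow> (\<forall>(a, b)\<in>parcs G. a \<in> S \<and> b \<notin> S \<longrightarrow>
    weight w (linked (parcs G) (pverts G - S) `` {b}) \<le> weight w S)" (is "_ \<longleftrightarrow> ?R")
proof -
  have S: "linked (parcs G) S `` {x} = S" if "x \<in> S" for x
    using that assms(1) linked_in[of x _ "parcs G" S] unfolding linked_set_def by blast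
  have "(\<lambda>x. linked (parcs G) S `` {x}) ` S = (\<lambda>x. S) ` S"
    using S by (rule image_cong[OF refl])
  also have "\<dots> = {S}" using assms(1) by (auto simp: linked_set_def)
  finally have 1: "verts ` components (with_proj G \<restriction> S) = {S}" by (simp add: verts_components_induce)
  let ?K = "\<lambda>x. linked (parcs G) (pverts G - S) `` {x}"
  have "w_safe G w S \<longleftrightarrow> (\<forall>C\<in>verts ` components (with_proj G \<restriction> S).
      \<forall>D\<in>verts ` components (with_proj G \<restriction> (pverts G - S)).
      (\<exists>u\<in>C. \<exists>v\<in>D. (u, v) \<in> parcs G) \<longrightarrow> weight w D \<le> weight w C)"
    using assms(2) by (simp add: w_safe_def adjacent_in_def)
  also have "\<dots> \<longleftrightarrow> (\<forall>x\<in>pverts G - S. (\<exists>u\<in>S. \<exists>v\<in>?K x. (u, v) \<in> parcs G) \<longrightarrow> weight w (?K x) \<le> weight w S)"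
    unfolding 1 unfolding verts_components_induce by simp
  also have "\<dots> \<longleftrightarrow> ?R"
  proof
    assume L: "\<forall>x\<in>pverts G - S. (\<exists>u\<in>S. \<exists>v\<in>?K x. (u, v) \<in> parcs G) \<longrightarrow> weight w (?K x) \<le> weight w S"
    show ?R
    proof clarify
      fix a b assume "(a, b) \<in> parcs G" "a \<in> S" "b \<notin> S"
      then show "weight w (?K b) \<le> weight w S"
        using L in_arcsD2[of a b] linked_class_self[of b "parcs G" "pverts G - S"] by blast
    qed
  next
    assume R: ?R
    show "\<forall>x\<in>pverts G - S. (\<exists>u\<in>S. \<exists>v\<in>?K x. (u, v) \<in> parcs G) \<longrightarrow> weight w (?K x) \<le> weight w S"
    proof (intro ballI impI, elim bexE)
      fix x u v assume x: "x \<in> pverts G - S" and u: "u \<in> S" and v: "v \<in> ?K x" and uv: "(u, v) \<in> parcs G"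
      have "v \<in> pverts G - S" using v x by (intro linked_in[of x v "parcs G"]) simp_all
      then have "v \<notin> S" by simp
      moreover have "?K v = ?K x"
        using v by (intro linked_class_eq sym_parcs) simp
      ultimately show "weight w (?K x) \<le> weight w S" using R u uv by fastforce
    qed
  qed
  finally show ?thesis .
qed

section \<open>Cycles from two edges between disjoint linked sets\<close>

lemma linked_apath:
  assumes "(x, y) \<in> linked (parcs G) X" "x \<in> X" "X \<subseteq> pverts G"
  obtains p where "apath x p y" "set (pawalk_verts x p) \<subseteq> X"
proof -
  interpret H: wf_digraph "with_proj G \<restriction> X" by (rule wellformed_induce_subgraph)
  from assms have "x \<rightarrow>\<^sup>*\<^bsub>with_proj G \<restriction> X\<^esub> y" by (simp add: reachable_induce_subgraph_iff)
  then obtain p where p: "H.apath x p y" by (auto simp: H.reachable_apath)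
  have av: "H.awalk_verts u q = pawalk_verts u q" for u q by (induct q arbitrary: u) auto
  have cas: "H.cas u q v \<longleftrightarrow> pcas u q v" for u q v by (induct q arbitrary: u) auto
  have "apath x p y" using p assms(2,3) 
    by (auto simp: H.apath_def apath_def H.awalk_def awalk_def av cas)
  moreover have "set (pawalk_verts x p) \<subseteq> X"
    using p H.awalk_conv[of x p y] by (simp add: H.apath_def av)
  ultimately show thesis by (rule that)
qed

text \<open>Both arcs are joined by a simple path from \<open>b\<close> to \<open>b'\<close> in
  \<open>Y\<close> and one from \<open>a'\<close> to \<open>a\<close> in \<open>X\<close>.
  Disjointness of \<open>X\<close> and \<open>Y\<close> keeps the vertices distinct, and
  \<open>b \<noteq> b'\<close> makes the path in \<open>Y\<close> nonempty, so the cycle has at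
  least three arcs.\<close>

lemma two_arcs_cycle:
  assumes XY: "X \<inter> Y = {}" "X \<subseteq> pverts G" "Y \<subseteq> pverts G"
    and a: "a \<in> X" "a' \<in> X" "(a', a) \<in> linked (parcs G) X"
    and b: "b \<in> Y" "b' \<in> Y" "(b, b') \<in> linked (parcs G) Y"
    and arcs: "(a, b) \<in> parcs G" "(b', a') \<in> parcs G" and ne: "b \<noteq> b'"
  shows "\<exists>p. cycle p \<and> 3 \<le> length p"
proof -
  obtain p where p: "apath b p b'" "set (pawalk_verts b p) \<subseteq> Y"
    using linked_apath b XY by blast
  obtain q where q: "apath a' q a" "set (pawalk_verts a' q) \<subseteq> X"
    using linked_apath a XY by blast
  have "p \<noteq> []" using p ne by (auto simp: apath_Nil_iff)
  let ?c = "(a, b) # p @ (b', a') # q"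
  have w: "awalk a ?c a"
    using p(1) q(1) arcs XY a by (auto simp: awalk_Cons_iff apath_def)
  have "pawalk_verts b (p @ (b', a') # q) = pawalk_verts b p @ pawalk_verts a' q"
    using awalk_verts_append[of b p "(b', a') # q" a] w p by (auto simp: awalk_Cons_iff apath_def)
  \<comment> \<open>The initial \<open>a\<close> is dropped because the closed walk ends there
    again.\<close>
  then have "distinct (tl (pawalk_verts a ?c))"
    using p q XY(1) by (auto simp: apath_def)
  then have "cycle ?c" using w by (auto simp: cycle_def)
  moreover have "3 \<le> length ?c" using \<open>p \<noteq> []\<close> by (cases p) auto
  ultimately show ?thesis by blast
qed
end

section \<open>Greedy growth in trees\<close>

text \<open>Some step of the path must leave \<open>X\<close>, and both its ends lie in
  \<open>Z\<close> since the path does.\<close>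

lemma linked_exit:
  assumes "(x, y) \<in> linked A Z" "x \<in> X" "y \<notin> X"
  obtains a b where "(a, b) \<in> A" "a \<in> Z" "b \<in> Z" "a \<in> X" "b \<notin> X"
proof -
  have "y \<in> X \<or> (\<exists>a b. (a, b) \<in> Restr A Z \<and> a \<in> X \<and> b \<notin> X)"
    using assms(1) unfolding linked_def by (induction rule: rtrancl_induct) (use assms(2) in blast)+
  then show thesis using assms(3) that by blast
qed

definition boundary :: "'a rel \<Rightarrow> 'a set \<Rightarrow> 'a set" where
  "boundary A X = A `` X - X"

lemma weight_mono: "X \<subseteq> Y \<Longrightarrow> finite Y \<Longrightarrow> weight w X \<le> weight w Y"
  unfolding weight_def by (rule sum_mono2) auto

lemma weight_insert: "finite X \<Longrightarrow> x \<notin> X \<Longrightarrow> weight w (insert x X) = w x + weight w X"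
  by (simp add: weight_def)

text \<open>Acyclicity enters through \<open>unique_end\<close>: used in both directions, it leaves
  at most one edge between two disjoint linked sets.\<close>

locale tree_rel =
  fixes V :: "'a set" and A :: "'a rel"
  assumes finite_V: "finite V" and sym_A: "sym A" and A_sub: "A \<subseteq> V \<times> V" and irrefl_A: "irrefl A"
    and linked_V: "linked_set A V"
    and unique_end: "\<And>X Y a a' b b'. X \<inter> Y = {} \<Longrightarrow> X \<subseteq> V \<Longrightarrow> Y \<subseteq> V \<Longrightarrow> linked_set A X \<Longrightarrow>
      linked_set A Y \<Longrightarrow> a \<in> X \<Longrightarrow> a' \<in> X \<Longrightarrow> b \<in> Y \<Longrightarrow> b' \<in> Y \<Longrightarrow> (a, b) \<in> A \<Longrightarrow> (a', b') \<in> A \<Longrightarrow> b = b'"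
begin

section \<open>Counting the edges of a tree\<close>

lemma linked_set_singleton: "linked_set A {x}"
  by (simp add: linked_set_def)

text \<open>The set is grown from a single vertex along arcs that leave it. Each new vertex has
  exactly one neighbour in the old set, so each step adds two arcs.\<close>

lemma linked_subset_arcs:
  assumes "Suc k \<le> card V"
  shows "\<exists>X. X \<subseteq> V \<and> linked_set A X \<and> card X = Suc k \<and> card (Restr A X) \<le> 2 * k"
  using assms
proof (induction k)
  case 0
  from linked_V obtain x where "x \<in> V" by (auto simp: linked_set_def)
  moreover have "Restr A {x} = {}" using irrefl_A by (auto simp: irrefl_def)
  ultimately show ?case using linked_set_singleton by (intro exI[of _ "{x}"]) auto
next
  case (Suc k)
  then obtain X where X: "X \<subseteq> V" "linked_set A X" "card X = Suc k" "card (Restr A X) \<le> 2 * k" by auto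
  then obtain x where x: "x \<in> X" by (auto simp: linked_set_def)
  have "X \<noteq> V" using X Suc.prems by auto
  then obtain y where y: "y \<in> V" "y \<notin> X" using X by auto
  have "(x, y) \<in> linked A V" using linked_V x y X by (auto simp: linked_set_def)
  then obtain a b where ab: "(a, b) \<in> A" "b \<in> V" "a \<in> X" "b \<notin> X"
    using x y(2) by (rule linked_exit)
  \<comment> \<open>\<open>unique_end\<close> for the singleton \<open>{b}\<close> and
    \<open>X\<close>: all arcs from \<open>b\<close> into \<open>X\<close> end in the same
    vertex.\<close>
  have uniq: "c = a" if "c \<in> X" "(b, c) \<in> A" for c
    using unique_end[of "{b}" X b b c a] that ab X linked_set_singleton sym_A by (auto dest: symD)
  have "Restr A (insert b X) \<subseteq> Restr A X \<union> {(a, b), (b, a)}"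
    using uniq sym_A irrefl_A by (auto simp: irrefl_def dest: symD)
  then have "card (Restr A (insert b X)) \<le> card (Restr A X \<union> {(a, b), (b, a)})"
    using X finite_V by (intro card_mono) (auto intro: finite_subset)
  also have "\<dots> \<le> card (Restr A X) + card {(a, b), (b, a)}" by (rule card_Un_le)
  also have "\<dots> \<le> 2 * Suc k" using X(4) card_insert_le_m1[of 2 "{(b, a)}" "(a, b)"] by simp
  finally have "card (Restr A (insert b X)) \<le> 2 * Suc k" .
  moreover have "card (insert b X) = Suc (Suc k)"
    using X ab finite_V by (simp add: finite_subset)
  ultimately show ?case
    using X ab linked_set_insert[OF sym_A X(2) ab(1,3)] by (intro exI[of _ "insert b X"]) auto
qed

text \<open>This bound ensures that the edge list fits into the input cells before the arrays, and
  that loops over \<open>n - 1\<close> edge slots see every edge.\<close>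

lemma card_arcs_le: "card A \<le> 2 * (card V - 1)"
proof -
  have "card V > 0" using finite_V linked_V by (auto simp: linked_set_def card_gt_0_iff)
  then obtain k where k: "card V = Suc k" by (cases "card V") auto
  then obtain X where X: "X \<subseteq> V" "card X = card V" "card (Restr A X) \<le> 2 * k"
    using linked_subset_arcs[of k] by auto
  then have "X = V" using finite_V by (simp add: card_subset_eq)
  then show ?thesis using X(3) A_sub k by (simp add: Int_absorb2)
qed

section \<open>Components outside a set and the greedy invariant\<close>

abbreviation outer :: "'a set \<Rightarrow> 'a \<Rightarrow> 'a set" where
  "outer X b \<equiv> linked A (V - X) `` {b}"

lemma boundary_V: "b \<in> boundary A X \<Longrightarrow> b \<in> V - X"
  using A_sub by (auto simp: boundary_def)

lemma outer_sub: "b \<in> V - X \<Longrightarrow> outer X b \<subseteq> V - X"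
  using linked_in[of b _ A "V - X"] by blast

lemma finite_outer: "b \<in> V - X \<Longrightarrow> finite (outer X b)"
  using outer_sub finite_V by (meson finite_Diff finite_subset)

text \<open>If the component of \<open>b\<close> met \<open>S\<close>, a path inside
  \<open>S\<close> would enter it. The entering arc must come from \<open>X\<close>, and
  \<open>unique_end\<close> forces it to end in \<open>b\<close>, which is not in
  \<open>S\<close>.\<close>

lemma outer_disjoint:
  assumes X: "X \<subseteq> V" "linked_set A X" and S: "S \<subseteq> V" "linked_set A S" "X \<subseteq> S"
    and b: "b \<in> boundary A X" "b \<notin> S"
  shows "outer X b \<inter> S = {}"
proof (rule ccontr)
  assume "outer X b \<inter> S \<noteq> {}"
  then obtain y where y: "y \<in> outer X b" "y \<in> S" by blast
  obtain a where a: "a \<in> X" "(a, b) \<in> A" using b by (auto simp: boundary_def)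
  have bV: "b \<in> V - X" using b boundary_V by blast
  have "(a, y) \<in> linked A S" using S a y by (auto simp: linked_set_def)
  moreover have "a \<in> - outer X b" using outer_sub[OF bV] a by blast
  moreover have "y \<notin> - outer X b" using y by blast
  ultimately obtain a' b' where ab': "(a', b') \<in> A" "a' \<in> S" "b' \<in> S" "a' \<notin> outer X b" "b' \<in> outer X b"
    by (rule linked_exit) blast
  \<comment> \<open>Otherwise \<open>a'\<close> would be in the same component of
    \<open>V - X\<close> as its neighbour \<open>b'\<close>.\<close>
  have "a' \<in> X"
  proof (rule ccontr)
    assume "a' \<notin> X"
    then have "(b', a') \<in> linked A (V - X)"
      using ab' S outer_sub[OF bV] sym_A by (intro linked_arc) (auto dest: symD)
    then show False using ab' by (auto intro: linked_trans)
  qed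
  then have "b = b'"
    using unique_end[of X "outer X b" a a' b b'] X a ab' outer_sub[OF bV]
      linked_set_class[OF sym_A, of "V - X" b] linked_class_self[of b A "V - X"]
    by blast
  then show False using ab' b by blast
qed

context
  fixes w :: "'a \<Rightarrow> nat"
begin

definition safe :: "'a set \<Rightarrow> bool" where
  "safe X \<longleftrightarrow> (\<forall>b\<in>boundary A X. weight w (outer X b) \<le> weight w X)"

definition conn_safe :: "'a set \<Rightarrow> bool" where
  "conn_safe S \<longleftrightarrow> S \<subseteq> V \<and> linked_set A S \<and> safe S"

text \<open>The growth does not know the optimal set, so the invariant speaks of all connected safe
  \<open>S\<close> containing \<open>r\<close> at once: either \<open>X\<close> has not left
  \<open>S\<close> yet, or both bounds hold that are available after leaving it. Here
  \<open>m\<close> bounds the weight of a vertex.\<close>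

definition greedy :: "nat \<Rightarrow> 'a \<Rightarrow> 'a set \<Rightarrow> bool" where
  "greedy m r X \<longleftrightarrow> X \<subseteq> V \<and> r \<in> X \<and> linked_set A X \<and>
     (\<forall>S. conn_safe S \<and> r \<in> S \<longrightarrow> X \<subseteq> S \<or>
        weight w X \<le> weight w S + m \<and> (\<forall>b\<in>boundary A X. weight w (outer X b) \<le> weight w S))"

lemma greedy_start: "r \<in> V \<Longrightarrow> greedy m r {r}"
  by (auto simp: greedy_def linked_set_singleton)

text \<open>Components only shrink when \<open>X\<close> grows. A new boundary vertex is a neighbour
  of \<open>b\<close>, so its component is part of the old component of \<open>b\<close>.\<close>

lemma outer_le_insert:
  assumes "b \<in> boundary A X" and le: "\<forall>b\<in>boundary A X. weight w (outer X b) \<le> c"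
    and b': "b' \<in> boundary A (insert b X)"
  shows "weight w (outer (insert b X) b') \<le> c"
proof -
  have mono: "outer (insert b X) b' \<subseteq> outer X b'"
    using linked_mono[of "V - insert b X" "V - X" A] by blast
  have b'V: "b' \<in> V - insert b X" using b' boundary_V by blast
  show ?thesis
  proof (cases "b' \<in> boundary A X")
    case True
    have "weight w (outer (insert b X) b') \<le> weight w (outer X b')"
      using mono b'V finite_outer[of b' X] by (intro weight_mono) auto
    then show ?thesis using True le by fastforce
  next
    case False
    then have "(b, b') \<in> A" using b' by (auto simp: boundary_def)
    then have "(b, b') \<in> linked A (V - X)"
      using assms(1) boundary_V b'V by (intro linked_arc) auto
    then have "outer X b' \<subseteq> outer X b" by (auto intro: linked_trans)
    then have "weight w (outer (insert b X) b') \<le> weight w (outer X b)"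
      using mono assms(1) boundary_V finite_outer[of b X] by (intro weight_mono) auto
    then show ?thesis using assms(1) le by fastforce
  qed
qed

text \<open>If \<open>insert b X\<close> is not inside \<open>S\<close>, all components next to
  \<open>X\<close> weigh at most \<open>weight w S\<close>. As \<open>X\<close> is strictly lighter
  than the component of \<open>b\<close>, it is lighter than \<open>S\<close>, and one more vertex
  exceeds that by at most \<open>m\<close>.\<close>

lemma greedy_step:
  assumes g: "greedy m r X" and m: "\<And>v. v \<in> V \<Longrightarrow> w v \<le> m"
    and b: "b \<in> boundary A X" "weight w X < weight w (outer X b)"
    and max: "\<forall>b'\<in>boundary A X. weight w (outer X b') \<le> weight w (outer X b)"
  shows "greedy m r (insert b X)"
proof -
  have X: "X \<subseteq> V" "r \<in> X" "linked_set A X" using g by (auto simp: greedy_def)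
  have bV: "b \<in> V - X" using b boundary_V by blast
  have wb: "weight w (insert b X) \<le> weight w X + m"
    using m[of b] bV X finite_V by (subst weight_insert) (auto intro: finite_subset)
  obtain a where a: "a \<in> X" "(a, b) \<in> A" using b by (auto simp: boundary_def)
  have "insert b X \<subseteq> S \<or> weight w (insert b X) \<le> weight w S + m \<and>
      (\<forall>b'\<in>boundary A (insert b X). weight w (outer (insert b X) b') \<le> weight w S)"
    if S: "conn_safe S" "r \<in> S" for S
  proof (cases "insert b X \<subseteq> S")
    case False
    have S': "S \<subseteq> V" "linked_set A S" "safe S" using S by (auto simp: conn_safe_def)
    have le: "\<forall>b'\<in>boundary A X. weight w (outer X b') \<le> weight w S"
    proof (cases "X \<subseteq> S")
      case True
      \<comment> \<open>This is the step at which the growth leaves \<open>S\<close>: the component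
        of \<open>b\<close> avoids \<open>S\<close>, so it lies in a component of
        \<open>V - S\<close>, which safety of \<open>S\<close> bounds.\<close>
      then have bS: "b \<notin> S" using False by blast
      have "outer X b \<inter> S = {}"
        using X(1,3) S'(1,2) True b(1) bS by (rule outer_disjoint)
      then have "outer X b \<subseteq> V - S" using outer_sub[OF bV] by blast
      then have "outer X b \<subseteq> outer S b"
        using linked_mono[of "outer X b" "V - S" A] linked_in_class[of b _ A "V - X"] by blast
      moreover have bd: "b \<in> boundary A S" using a bS True by (auto simp: boundary_def)
      ultimately have "weight w (outer X b) \<le> weight w (outer S b)"
        using finite_outer[of b S] boundary_V[of b S] by (intro weight_mono) simp_all
      also have "\<dots> \<le> weight w S" using S'(3) bd by (auto simp: safe_def)
      \<comment> \<open>Since \<open>b\<close> was chosen in a heaviest component, its bound carries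
        over to all the others.\<close>
      finally show ?thesis using max by fastforce
    next
      case False
      then show ?thesis using g S by (auto simp: greedy_def)
    qed
    then have "weight w X \<le> weight w S" using b by fastforce
    then show ?thesis using wb outer_le_insert[OF b(1) le] by fastforce
  qed blast
  then show ?thesis
    using X bV linked_set_insert[OF sym_A X(3) a(2,1)] unfolding greedy_def by blast
qed

lemma greedy_le:
  assumes "greedy m r X" "conn_safe S" "r \<in> S"
  shows "weight w X \<le> weight w S + m"
proof (cases "X \<subseteq> S")
  case True
  then have "weight w X \<le> weight w S"
    using assms(2) finite_V by (intro weight_mono) (auto simp: conn_safe_def intro: finite_subset)
  then show ?thesis by simp
qed (use assms in \<open>auto simp: greedy_def\<close>)

end

end

section \<open>Total correctness with running time\<close>

text \<open>Cost of one pass in which every guard and loop body is charged once; a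
  \<open>Cond\<close> is charged for both branches, which covers either.\<close>

primrec csize :: "com \<Rightarrow> nat" where
  "csize Skip = 1"
| "csize (NStore a e) = 1 + ncost a + ncost e"
| "csize (RStore a x) = 1 + ncost a + rcost x"
| "csize (Seq P Q) = csize P + csize Q"
| "csize (Cond b P Q) = 1 + bcost b + csize P + csize Q"
| "csize (While b P) = 1 + bcost b + csize P"

primrec loop_depth :: "com \<Rightarrow> nat" where
  "loop_depth Skip = 0"
| "loop_depth (NStore a e) = 0"
| "loop_depth (RStore a x) = 0"
| "loop_depth (Seq P Q) = max (loop_depth P) (loop_depth Q)"
| "loop_depth (Cond b P Q) = max (loop_depth P) (loop_depth Q)"
| "loop_depth (While b P) = Suc (loop_depth P)"

text \<open>
  Bounds the running time if every loop makes at most \<open>n\<close> iterations each time it is entered.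
\<close>

definition time_bound :: "nat \<Rightarrow> com \<Rightarrow> nat" where
  "time_bound n P = csize P * (n + 1) ^ loop_depth P"

text \<open>Total correctness with a time bound that depends only on the program and
  \<open>n\<close>, so the rules compose without tracking elapsed time in assertions.\<close>

definition wp :: "nat \<Rightarrow> com \<Rightarrow> (state \<Rightarrow> bool) \<Rightarrow> state \<Rightarrow> bool" where
  "wp n P Q s \<longleftrightarrow> (\<exists>t s'. exec P s t s' \<and> t \<le> time_bound n P \<and> Q s')"

lemma wp_mono: "wp n P Q s \<Longrightarrow> (\<And>s. Q s \<Longrightarrow> Q' s) \<Longrightarrow> wp n P Q' s"
  unfolding wp_def by blast

lemma wp_Skip [simp]: "wp n Skip Q s \<longleftrightarrow> Q s"
proof
  assume "Q s"
  then show "wp n Skip Q s"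
    unfolding wp_def time_bound_def using exec.Skip[of s] by fastforce
qed (auto simp: wp_def elim: exec_SkipE)

lemma wp_NStore: "wp n (NStore a e) Q s \<longleftrightarrow> Q ((fst s)(nval a s := nval e s), snd s)"
proof
  assume "Q ((fst s)(nval a s := nval e s), snd s)"
  then show "wp n (NStore a e) Q s"
    unfolding wp_def time_bound_def using exec.NStore[of a e s] by fastforce
qed (auto simp: wp_def elim: exec_NStoreE)

lemma wp_RStore: "wp n (RStore a x) Q s \<longleftrightarrow> Q (fst s, (snd s)(nval a s := rval x s))"
proof
  assume "Q (fst s, (snd s)(nval a s := rval x s))"
  then show "wp n (RStore a x) Q s"
    unfolding wp_def time_bound_def using exec.RStore[of a x s] by fastforce
qed (auto simp: wp_def elim: exec_RStoreE)

lemma time_bound_le: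
  "loop_depth P \<le> d \<Longrightarrow> time_bound n P \<le> csize P * (n + 1) ^ d"
  unfolding time_bound_def by (intro mult_le_mono power_increasing) auto

lemma wp_Seq:
  assumes "wp n P (wp n Q R) s"
  shows "wp n (Seq P Q) R s"
proof -
  from assms obtain t s' u s'' where *: "exec P s t s'" "t \<le> time_bound n P"
      "exec Q s' u s''" "u \<le> time_bound n Q" "R s''"
    unfolding wp_def by blast
  let ?d = "loop_depth (Seq P Q)"
  have "t + u \<le> csize P * (n + 1) ^ ?d + csize Q * (n + 1) ^ ?d"
    using *(2,4) time_bound_le[of P ?d n] time_bound_le[of Q ?d n] by simp
  also have "\<dots> = time_bound n (Seq P Q)" by (simp add: time_bound_def algebra_simps)
  finally show ?thesis unfolding wp_def using * exec.Seq by blast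
qed

lemma wp_Cond:
  assumes "bval b s \<Longrightarrow> wp n P R s" "\<not> bval b s \<Longrightarrow> wp n Q R s"
  shows "wp n (Cond b P Q) R s"
proof -
  let ?d = "loop_depth (Cond b P Q)"
  let ?p = "(n + 1) ^ ?d"
  have "1 + bcost b \<le> (1 + bcost b) * ?p" using mult_le_mono2[of 1 ?p "1 + bcost b"] by simp
  moreover have "time_bound n (Cond b P Q) = (1 + bcost b) * ?p + csize P * ?p + csize Q * ?p"
    by (simp add: time_bound_def algebra_simps)
  ultimately have le: "1 + bcost b + t \<le> time_bound n (Cond b P Q)"
    if "t \<le> time_bound n P \<or> t \<le> time_bound n Q" for t
    using that time_bound_le[of P ?d n] time_bound_le[of Q ?d n] by fastforce
  show ?thesis
  proof (cases "bval b s")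
    case True
    with assms(1) obtain t s' where "exec P s t s'" "t \<le> time_bound n P" "R s'"
      unfolding wp_def by blast
    then show ?thesis unfolding wp_def using exec.CondTrue[OF True] le by blast
  next
    case False
    with assms(2) obtain t s' where "exec Q s t s'" "t \<le> time_bound n Q" "R s'"
      unfolding wp_def by blast
    then show ?thesis unfolding wp_def using exec.CondFalse[OF False] le by blast
  qed
qed

text \<open>The invariant is indexed by the number of completed rounds, and the loop makes exactly
  \<open>N\<close> of them.\<close>

lemma wp_While:
  assumes "I 0 s" "N \<le> n"
    and step: "\<And>k s. k < N \<Longrightarrow> I k s \<Longrightarrow> bval b s \<and> wp n P (I (Suc k)) s"
    and stop: "\<And>s. I N s \<Longrightarrow> \<not> bval b s \<and> Q s"
  shows "wp n (While b P) Q s"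
proof -
  have "\<exists>t s'. exec (While b P) s t s' \<and> t \<le> j * (1 + bcost b + time_bound n P) + 1 + bcost b \<and> Q s'"
    if "I k s" "k + j = N" for j k s
    using that
  proof (induction j arbitrary: k s)
    case 0
    then show ?case using stop[of s] exec.WhileFalse[of b s P] by fastforce
  next
    case (Suc j)
    then obtain t s' where 1: "exec P s t s'" "t \<le> time_bound n P" "I (Suc k) s'" "bval b s"
      using step[of k s] unfolding wp_def by auto
    obtain u s'' where 2: "exec (While b P) s' u s''"
        "u \<le> j * (1 + bcost b + time_bound n P) + 1 + bcost b" "Q s''"
      using Suc.IH[OF 1(3)] Suc.prems by auto
    have "exec (While b P) s (1 + bcost b + t + u) s''"
      using 1 2 by (intro exec.WhileTrue)
    moreover have "1 + bcost b + t + u \<le> Suc j * (1 + bcost b + time_bound n P) + 1 + bcost b"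
      using 1(2) 2(2) by simp
    ultimately show ?case using 2(3) by blast
  qed
  from this[of 0 s N] assms(1) obtain t s' where *: "exec (While b P) s t s'"
      "t \<le> N * (1 + bcost b + time_bound n P) + 1 + bcost b" "Q s'" by auto
  let ?p = "(n + 1) ^ loop_depth P"
  have "1 + bcost b \<le> (1 + bcost b) * ?p" using mult_le_mono2[of 1 ?p "1 + bcost b"] by simp
  then have body: "1 + bcost b + time_bound n P \<le> (1 + bcost b + csize P) * ?p"
    unfolding time_bound_def distrib_right by linarith
  \<comment> \<open>The last, failing evaluation of the guard is charged as one further round; this
    is why \<open>time_bound\<close> uses powers of \<open>n + 1\<close>.\<close>
  have "N * (1 + bcost b + time_bound n P) + (1 + bcost b)
      \<le> n * (1 + bcost b + time_bound n P) + (1 + bcost b + time_bound n P)"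
    by (rule add_mono[OF mult_le_mono1[OF assms(2)] le_add1])
  also have "\<dots> = (n + 1) * (1 + bcost b + time_bound n P)" by simp
  also have "\<dots> \<le> (n + 1) * ((1 + bcost b + csize P) * ?p)" using body by (intro mult_le_mono) auto
  also have "\<dots> = time_bound n (While b P)" by (simp add: time_bound_def algebra_simps)
  finally have "t \<le> time_bound n (While b P)" using *(2) by simp
  then show ?thesis unfolding wp_def using * by blast
qed

text \<open>
  The cells \<open>0, \<dots>, 2n - 2\<close> hold the input.  They are followed by three arrays of length \<open>n\<close>: the
  characteristic vector of the current set \<open>X\<close>, the labels \<open>L\<close> of the components outside \<open>X\<close>, and the
  characteristic vector \<open>B\<close> of the best set so far.  Scalar variables come last.
\<close>

definition nmem :: "nat \<Rightarrow> (nat \<Rightarrow> nat) \<Rightarrow> nat set \<Rightarrow> (nat \<Rightarrow> nat) \<Rightarrow> (nat \<Rightarrow> nat) \<Rightarrow> (nat \<Rightarrow> nat) \<Rightarrow> nat \<Rightarrow> nat" where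
  "nmem n E X L B v = (\<lambda>a. if a < 2 * n then E a else if a < 3 * n then of_bool (a - 2 * n \<in> X)
     else if a < 4 * n then L (a - 3 * n) else if a < 5 * n then B (a - 4 * n) else v (a - 5 * n))"

definition rmem :: "nat \<Rightarrow> real \<Rightarrow> (nat \<Rightarrow> nat) \<Rightarrow> (nat \<Rightarrow> real) \<Rightarrow> nat \<Rightarrow> real" where
  "rmem n \<epsilon> w r = (\<lambda>a. if a = 0 then \<epsilon> else if a \<le> n then real (w (a - 1)) else r (a - n - 1))"

text \<open>Natural numbers cannot be multiplied on the machine, so a fixed multiple of
  \<open>n\<close> is a chain of additions of cell 0, of constant cost for constant
  \<open>k\<close>.\<close>

definition times_n :: "nat \<Rightarrow> nexp" where
  "times_n k = ((NPlus (NCell (NLit 0))) ^^ k) (NLit 0)"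

definition "var k = NCell (NPlus (times_n 5) (NLit k))"
definition "set_var k e = NStore (NPlus (times_n 5) (NLit k)) e"
definition "in_X e = NCell (NPlus (times_n 2) e)"
definition "set_X e k = NStore (NPlus (times_n 2) e) (NLit k)"
definition "label_of e = NCell (NPlus (times_n 3) e)"
definition "set_label e f = NStore (NPlus (times_n 3) e) f"
definition "in_B e = NCell (NPlus (times_n 4) e)"
definition "set_B e f = NStore (NPlus (times_n 4) e) f"
text \<open>Cell 0 is taken by \<open>n\<close>, which shifts the ends of edge \<open>e\<close> to
  the cells \<open>2 * e + 1\<close> and \<open>2 * e + 2\<close>.\<close>

definition "end1 e = NCell (NPlus (NPlus e e) (NLit 1))"
definition "end2 e = NCell (NPlus (NPlus e e) (NLit 2))"
definition "wt e = RCell (NPlus e (NLit 1))"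
definition "rvar k = RCell (NPlus (times_n 1) (NLit (Suc k)))"
definition "set_rvar k x = RStore (NPlus (times_n 1) (NLit (Suc k))) x"

definition for_loop :: "nat \<Rightarrow> nexp \<Rightarrow> com \<Rightarrow> com" where
  "for_loop k e P = Seq (set_var k (NLit 0))
     (While (NLess (var k) e) (Seq P (set_var k (NPlus (var k) (NLit 1)))))"

lemma wp_for_loop:
  assumes "wp n (set_var k (NLit 0)) (I 0) s" "N \<le> n"
    and "\<And>i s. i \<le> N \<Longrightarrow> I i s \<Longrightarrow> nval (var k) s = i \<and> nval e s = N"
    and "\<And>i s. i < N \<Longrightarrow> I i s \<Longrightarrow> wp n P (wp n (set_var k (NPlus (var k) (NLit 1))) (I (Suc i))) s"
    and "\<And>s. I N s \<Longrightarrow> Q s"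
  shows "wp n (for_loop k e P) Q s"
  unfolding for_loop_def
proof (rule wp_Seq, rule wp_mono[OF assms(1)], rule wp_While[where I = I and N = N])
  show "bval (NLess (var k) e) s \<and>
      wp n (Seq P (set_var k (NPlus (var k) (NLit 1)))) (I (Suc i)) s" if "i < N" "I i s" for i s
    using that assms(3)[of i s] wp_Seq[OF assms(4)[OF that]] by simp
  show "\<not> bval (NLess (var k) e) s \<and> Q s" if "I N s" for s
    using that assms(3)[of N s] assms(5) by simp
qed (use assms in auto)

section \<open>Symbolic execution on the structured memory\<close>

locale machine =
  fixes n :: nat and \<epsilon> :: real and w :: "nat \<Rightarrow> nat"
  assumes n_pos: "0 < n"
begin

abbreviation st where
  "st E X L B v r \<equiv> (nmem n E X L B v, rmem n \<epsilon> w r)"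

lemma nval_times_n [simp]:
  "E 0 = n \<Longrightarrow> nval (times_n k) (st E X L B v r) = k * n"
  unfolding times_n_def using n_pos by (induction k) (simp_all add: nmem_def)

lemma nval_var [simp]: "E 0 = n \<Longrightarrow> nval (var k) (st E X L B v r) = v k"
  by (simp add: var_def) (simp add: nmem_def)

lemma nval_in_X [simp]:
  "E 0 = n \<Longrightarrow> nval e (st E X L B v r) < n \<Longrightarrow>
    nval (in_X e) (st E X L B v r) = of_bool (nval e (st E X L B v r) \<in> X)"
  by (simp add: in_X_def) (simp add: nmem_def)

lemma nval_label_of [simp]:
  "E 0 = n \<Longrightarrow> nval e (st E X L B v r) < n \<Longrightarrow>
    nval (label_of e) (st E X L B v r) = L (nval e (st E X L B v r))"
  by (simp add: label_of_def) (simp add: nmem_def)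

lemma nval_in_B [simp]:
  "E 0 = n \<Longrightarrow> nval e (st E X L B v r) < n \<Longrightarrow>
    nval (in_B e) (st E X L B v r) = B (nval e (st E X L B v r))"
  by (simp add: in_B_def) (simp add: nmem_def)

lemma nval_end1:
  "Suc (nval e (st E X L B v r)) < n \<Longrightarrow>
    nval (end1 e) (st E X L B v r) = E (2 * nval e (st E X L B v r) + 1)"
  by (simp add: end1_def) (simp add: nmem_def mult_2)

lemma nval_end2:
  "Suc (nval e (st E X L B v r)) < n \<Longrightarrow>
    nval (end2 e) (st E X L B v r) = E (2 * nval e (st E X L B v r) + 2)"
  by (simp add: end2_def) (simp add: nmem_def mult_2)

lemma rval_wt [simp]:
  "nval e (st E X L B v r) < n \<Longrightarrow> rval (wt e) (st E X L B v r) = real (w (nval e (st E X L B v r)))"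
  by (simp add: wt_def) (simp add: rmem_def)

lemma rval_rvar [simp]: "E 0 = n \<Longrightarrow> rval (rvar k) (st E X L B v r) = r k"
  by (simp add: rvar_def) (simp add: rmem_def)

lemma wp_set_var [simp]:
  "E 0 = n \<Longrightarrow> wp n (set_var k e) Q (st E X L B v r) \<longleftrightarrow>
    Q (st E X L B (v(k := nval e (st E X L B v r))) r)"
proof -
  have "(nmem n E X L B v)(5 * n + k := y) = nmem n E X L B (v(k := y))" for y
    by (auto simp: nmem_def fun_eq_iff)
  then show "E 0 = n \<Longrightarrow> ?thesis" by (simp add: set_var_def wp_NStore)
qed

lemma wp_set_X [simp]:
  assumes "E 0 = n" "nval e (st E X L B v r) < n"
  shows "wp n (set_X e (Suc 0)) Q (st E X L B v r) \<longleftrightarrow> Q (st E (insert (nval e (st E X L B v r)) X) L B v r)"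
    and "wp n (set_X e 0) Q (st E X L B v r) \<longleftrightarrow> Q (st E (X - {nval e (st E X L B v r)}) L B v r)"
proof -
  have "(nmem n E X L B v)(2 * n + x := 1) = nmem n E (insert x X) L B v"
    "(nmem n E X L B v)(2 * n + x := 0) = nmem n E (X - {x}) L B v" if "x < n" for x
    using that by (auto simp: nmem_def fun_eq_iff)
  then show "wp n (set_X e (Suc 0)) Q (st E X L B v r) \<longleftrightarrow> Q (st E (insert (nval e (st E X L B v r)) X) L B v r)"
    "wp n (set_X e 0) Q (st E X L B v r) \<longleftrightarrow> Q (st E (X - {nval e (st E X L B v r)}) L B v r)"
    using assms by (simp_all add: set_X_def wp_NStore)
qed

lemma wp_set_label [simp]:
  assumes "E 0 = n" "nval e (st E X L B v r) < n"
  shows "wp n (set_label e f) Q (st E X L B v r) \<longleftrightarrow>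
    Q (st E X (L(nval e (st E X L B v r) := nval f (st E X L B v r))) B v r)"
proof -
  have "(nmem n E X L B v)(3 * n + x := y) = nmem n E X (L(x := y)) B v" if "x < n" for x y
    using that by (auto simp: nmem_def fun_eq_iff)
  then show ?thesis using assms by (simp add: set_label_def wp_NStore)
qed

lemma wp_set_B [simp]:
  assumes "E 0 = n" "nval e (st E X L B v r) < n"
  shows "wp n (set_B e f) Q (st E X L B v r) \<longleftrightarrow>
    Q (st E X L (B(nval e (st E X L B v r) := nval f (st E X L B v r))) v r)"
proof -
  have "(nmem n E X L B v)(4 * n + x := y) = nmem n E X L (B(x := y)) v" if "x < n" for x y
    using that by (auto simp: nmem_def fun_eq_iff)
  then show ?thesis using assms by (simp add: set_B_def wp_NStore)
qed

lemma wp_set_rvar [simp]: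
  "E 0 = n \<Longrightarrow> wp n (set_rvar k x) Q (st E X L B v r) \<longleftrightarrow>
    Q (st E X L B v (r(k := rval x (st E X L B v r))))"
proof -
  have "(rmem n \<epsilon> w r)(n + Suc k := y) = rmem n \<epsilon> w (r(k := y))" for y
    by (auto simp: rmem_def fun_eq_iff)
  then show "E 0 = n \<Longrightarrow> ?thesis" by (simp add: set_rvar_def wp_RStore)
qed

text \<open>Serves the output phase, which overwrites input cells and finally cell 0; so
  \<open>E 0 = n\<close> is not assumed.\<close>

lemma wp_set_E:
  assumes "nval e (st E X L B v r) < n"
  shows "wp n (NStore e f) Q (st E X L B v r) \<longleftrightarrow>
    Q (st (E(nval e (st E X L B v r) := nval f (st E X L B v r))) X L B v r)"
proof -
  have "(nmem n E X L B v)(x := y) = nmem n (E(x := y)) X L B v" if "x < n" for x y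
    using that by (auto simp: nmem_def fun_eq_iff)
  then show ?thesis using assms by (simp add: wp_NStore)
qed

end

section \<open>The program\<close>

text \<open>
  Variables: 0 the start vertex, 1 the round, 2 the edge, 3 the vertex of an inner loop, 4 and 5 the labels
  being merged, 6 the vertex selected so far (\<open>n\<close> if none), 7 the candidate.  Real variables: 0 the weight
  of \<open>X\<close>, 1 the largest component weight found, 2 the weight of the candidate's component, 3 the
  weight of the best set.  The loops run over \<open>n - 1\<close> edges; missing ones read as the harmless loop at 0.
\<close>

definition "num_eq a b = BAnd (BNot (NLess a b)) (BNot (NLess b a))"

definition "init_labels = for_loop 3 (times_n 1) (set_label (var 3) (var 3))"

definition "relabel =
  for_loop 3 (times_n 1) (Cond (num_eq (label_of (var 3)) (var 4)) (set_label (var 3) (var 5)) Skip)"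

text \<open>Counts ends: 0 marks an edge outside \<open>X\<close> and 1 a boundary edge. A loop
  counts 0 or 2 and is never taken for a boundary edge.\<close>

definition "ends_in_X = NPlus (in_X (end1 (var 2))) (in_X (end2 (var 2)))"

text \<open>Both labels are copied to variables first, because \<open>relabel\<close> changes the
  array they are read from.\<close>

definition "merge_labels = for_loop 2 (NMinus (times_n 1) (NLit 1))
  (Cond (NLess ends_in_X (NLit 1))
    (Seq (set_var 4 (label_of (end1 (var 2)))) (Seq (set_var 5 (label_of (end2 (var 2)))) relabel)) Skip)"

definition "sum_component = Seq (set_rvar 2 (RNat (NLit 0))) (for_loop 3 (times_n 1)
  (Cond (num_eq (label_of (var 3)) (label_of (var 7))) (set_rvar 2 (RPlus (rvar 2) (wt (var 3)))) Skip))"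

definition "try_edge = Seq
  (Cond (NLess (NLit 0) (in_X (end1 (var 2)))) (set_var 7 (end2 (var 2))) (set_var 7 (end1 (var 2))))
  (Seq sum_component (Cond (RLess (rvar 1) (rvar 2)) (Seq (set_rvar 1 (rvar 2)) (set_var 6 (var 7))) Skip))"

definition "select = Seq (set_var 6 (times_n 1)) (Seq (set_rvar 1 (rvar 0))
  (for_loop 2 (NMinus (times_n 1) (NLit 1)) (Cond (num_eq ends_in_X (NLit 1)) try_edge Skip)))"

definition "add_selected = Cond (NLess (var 6) (times_n 1))
  (Seq (set_X (var 6) 1) (set_rvar 0 (RPlus (rvar 0) (wt (var 6))))) Skip"

definition "grow_once = Seq init_labels (Seq merge_labels (Seq select add_selected))"

text \<open>Always \<open>n\<close> rounds: once \<open>X\<close> is safe, the remaining rounds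
  leave it unchanged.\<close>

definition "grow = for_loop 1 (times_n 1) grow_once"

definition "start = Seq (for_loop 3 (times_n 1) (set_X (var 3) 0))
  (Seq (set_X (var 0) 1) (set_rvar 0 (wt (var 0))))"

text \<open>The test on variable 0 forces recording for the first start vertex, when real variable 3
  holds no weight of a safe set yet.\<close>

definition "record_best = Cond (BAnd (NLess (NLit 0) (var 0)) (BNot (RLess (rvar 0) (rvar 3)))) Skip
  (Seq (set_rvar 3 (rvar 0)) (for_loop 3 (times_n 1) (set_B (var 3) (in_X (var 3)))))"

definition "search = for_loop 0 (times_n 1) (Seq start (Seq grow record_best))"

text \<open>Cell 0 holds \<open>n\<close>, on which all addresses depend, and so is overwritten last.\<close>

definition "write_output = Seq (for_loop 3 (NMinus (times_n 1) (NLit 1))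
    (NStore (NPlus (var 3) (NLit 1)) (in_B (NPlus (var 3) (NLit 1)))))
  (NStore (NLit 0) (in_B (NLit 0)))"

definition "safe_set_program = Seq search write_output"

section \<open>Merging label classes along an edge\<close>

lemma bval_num_eq [simp]: "bval (num_eq a b) s \<longleftrightarrow> nval a s = nval b s"
  by (auto simp: num_eq_def)

text \<open>Adding the edge between \<open>u\<close> and \<open>v\<close> unites their two classes,
  and replacing the label of \<open>u\<close> by that of \<open>v\<close> does the same to the
  labels.\<close>

lemma merged_labels_iff:
  assumes L: "\<And>x y. x \<in> V \<Longrightarrow> y \<in> V \<Longrightarrow> L x = L y \<longleftrightarrow> (x, y) \<in> R\<^sup>*"
    and R: "R \<subseteq> V \<times> V" and V: "u \<in> V" "v \<in> V" "x \<in> V" "y \<in> V"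
  shows "(if L x = L u then L v else L x) = (if L y = L u then L v else L y) \<longleftrightarrow>
    (x, y) \<in> (R \<union> {(u, v), (v, u)})\<^sup>*" (is "?L x = ?L y \<longleftrightarrow> _ \<in> ?R\<^sup>*")
proof
  assume "(x, y) \<in> ?R\<^sup>*"
  then have "y \<in> V \<and> ?L x = ?L y"
  proof (induction rule: rtrancl_induct)
    case base
    then show ?case using V by simp
  next
    case (step y z)
    have "z \<in> V" "(y, z) \<in> R \<Longrightarrow> L y = L z" using step R V L[of y z] by auto
    then show ?case using step by auto
  qed
  then show "?L x = ?L y" by simp
next
  assume eq: "?L x = ?L y"
  have mono: "(a, b) \<in> ?R\<^sup>*" if "a \<in> V" "b \<in> V" "L a = L b" for a b
    using that L rtrancl_mono[of R ?R] by blast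
  have uv: "(u, v) \<in> ?R\<^sup>*" "(v, u) \<in> ?R\<^sup>*" by auto
  \<comment> \<open>New labels agree if the old ones did, or if one vertex was in the class of
    \<open>u\<close> and the other in that of \<open>v\<close>.\<close>
  consider "L x = L y" | "L x = L u" "L v = L y" | "L y = L u" "L x = L v" using eq by (auto split: if_splits)
  then show "(x, y) \<in> ?R\<^sup>*"
  proof cases
    case 1
    then show ?thesis using mono V by blast
  next
    case 2
    then have "(x, u) \<in> ?R\<^sup>*" "(v, y) \<in> ?R\<^sup>*" using mono V by blast+
    then show ?thesis using uv(1) by (meson rtrancl_trans)
  next
    case 3
    then have "(x, v) \<in> ?R\<^sup>*" "(u, y) \<in> ?R\<^sup>*" using mono V by (metis, metis)
    then show ?thesis using uv(2) by (meson rtrancl_trans)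
  qed
qed

text \<open>There are \<open>n - 1\<close> edge slots, and \<open>edge\<close> admits loops for
  slots beyond the end of the list. \<open>arc_listed\<close> compares sets of arcs because a listed
  edge may have either orientation.\<close>

locale safe_set_input = tree_rel "{..<n}" A + machine n \<epsilon> w
  for n :: nat and A :: "nat rel" and \<epsilon> :: real and w :: "nat \<Rightarrow> nat" +
  fixes E src dst :: "nat \<Rightarrow> nat"
  assumes E_0 [simp]: "E 0 = n"
    and src_eq: "src = (\<lambda>e. E (2 * e + 1))" and dst_eq: "dst = (\<lambda>e. E (2 * e + 2))"
    and edge: "\<And>e. Suc e < n \<Longrightarrow> (src e, dst e) \<in> A \<or> src e = dst e \<and> src e < n"
    and arc_listed: "\<And>a b. (a, b) \<in> A \<Longrightarrow> \<exists>e. Suc e < n \<and> {(a, b), (b, a)} = {(src e, dst e), (dst e, src e)}"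
begin

lemma nval_ends [simp]:
  assumes "Suc (nval e (st E X L B v r)) < n"
  shows "nval (end1 e) (st E X L B v r) = src (nval e (st E X L B v r))"
    and "nval (end2 e) (st E X L B v r) = dst (nval e (st E X L B v r))"
  using assms by (simp_all only: nval_end1 nval_end2 src_eq dst_eq)

definition first_arcs :: "nat \<Rightarrow> nat rel" where
  "first_arcs i = (\<Union>e<i. {(src e, dst e), (dst e, src e)})"

lemma ends_less [simp]: "Suc e < n \<Longrightarrow> src e < n" "Suc e < n \<Longrightarrow> dst e < n"
  using edge[of e] A_sub by auto

lemma first_arcs_Suc: "first_arcs (Suc i) = first_arcs i \<union> {(src i, dst i), (dst i, src i)}"
  by (auto simp: first_arcs_def less_Suc_eq)

lemma first_arcs_0: "first_arcs 0 = {}"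
  by (simp add: first_arcs_def)

lemma first_arcs_sub: "i \<le> n - 1 \<Longrightarrow> first_arcs i \<subseteq> {..<n} \<times> {..<n}"
  unfolding first_arcs_def by (intro UN_least) simp

lemma first_arcs_all: "a \<noteq> b \<Longrightarrow> (a, b) \<in> first_arcs (n - 1) \<longleftrightarrow> (a, b) \<in> A"
proof
  assume "(a, b) \<in> A"
  then obtain e where "Suc e < n" "(a, b) \<in> {(src e, dst e), (dst e, src e)}"
    using arc_listed by blast
  then show "(a, b) \<in> first_arcs (n - 1)" unfolding first_arcs_def by (intro UN_I[of e]) simp_all
next
  assume "a \<noteq> b" "(a, b) \<in> first_arcs (n - 1)"
  then obtain e where "e < n - 1" "(a, b) \<in> {(src e, dst e), (dst e, src e)}"
    unfolding first_arcs_def by blast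
  then show "(a, b) \<in> A" using \<open>a \<noteq> b\<close> edge[of e] symD[OF sym_A, of "src e" "dst e"] by auto
qed

text \<open>The two restricted relations differ at most by loops from padding slots, which the
  reflexive closure absorbs.\<close>

lemma linked_first_arcs: "linked (first_arcs (n - 1)) (- X) = linked A ({..<n} - X)"
proof -
  have "(a, b) \<in> Restr (first_arcs (n - 1)) (- X) \<union> Id \<longleftrightarrow> (a, b) \<in> Restr A ({..<n} - X) \<union> Id" for a b
    using first_arcs_all[of a b] A_sub by (cases "a = b") auto
  then have "Restr (first_arcs (n - 1)) (- X) \<union> Id = Restr A ({..<n} - X) \<union> Id"
    by (intro set_eqI) (simp add: split_paired_all)
  then show ?thesis
    unfolding linked_def by (metis rtrancl_reflcl)
qed

lemma boundary_first_arcs: "boundary (first_arcs (n - 1)) X = boundary A X"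
proof -
  have "(\<exists>a\<in>X. (a, b) \<in> first_arcs (n - 1)) \<longleftrightarrow> (\<exists>a\<in>X. (a, b) \<in> A)" if "b \<notin> X" for b
    using that first_arcs_all[of _ b] by metis
  then show ?thesis unfolding boundary_def by (simp add: set_eq_iff Image_iff) blast
qed

section \<open>Correctness of the parts of the program\<close>

lemma wp_init_labels:
  assumes "Q (st E X (\<lambda>x. if x < n then x else L x) B (v(3 := n)) r)"
  shows "wp n init_labels Q (st E X L B v r)"
proof -
  have [simp]: "(\<lambda>x. if x < i then x else L x)(i := i) = (\<lambda>x. if x < Suc i then x else L x)" for i
    by (auto simp: fun_eq_iff)
  show ?thesis unfolding init_labels_def
    by (rule wp_for_loop[where N = n and I = "\<lambda>i s. s = st E X (\<lambda>x. if x < i then x else L x) B (v(3 := i)) r"])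
      (use assms in auto)
qed

lemma wp_relabel:
  assumes "Q (st E X (\<lambda>x. if x < n \<and> L x = v 4 then v 5 else L x) B (v(3 := n)) r)"
  shows "wp n relabel Q (st E X L B v r)"
proof -
  let ?L = "\<lambda>i x. if x < i \<and> L x = v 4 then v 5 else L x"
  have [simp]: "(?L i)(i := v 5) = ?L (Suc i)" if "L i = v 4" for i
    using that by (auto simp: fun_eq_iff less_Suc_eq)
  have [simp]: "?L (Suc i) = ?L i" if "L i \<noteq> v 4" for i
    using that by (auto simp: fun_eq_iff less_Suc_eq)
  show ?thesis unfolding relabel_def
    by (rule wp_for_loop[where N = n and I = "\<lambda>i s. s = st E X (?L i) B (v(3 := i)) r"])
      (use assms in \<open>auto intro!: wp_Cond\<close>)
qed

text \<open>After \<open>i\<close> edges, labels agree exactly for vertices linked by these edges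
  outside \<open>X\<close>. Pairwise distinct initial labels are the case of no edges; only equality
  of labels matters, so their values stay existential.\<close>

lemma wp_merge_labels:
  assumes L: "\<And>x y. x < n \<Longrightarrow> y < n \<Longrightarrow> L x = L y \<longleftrightarrow> x = y"
    and Q: "\<And>L' v'. (\<And>x y. x < n \<Longrightarrow> y < n \<Longrightarrow> L' x = L' y \<longleftrightarrow> (x, y) \<in> linked A ({..<n} - X)) \<Longrightarrow>
      v' 0 = v 0 \<Longrightarrow> v' 1 = v 1 \<Longrightarrow> Q (st E X L' B v' r)"
  shows "wp n merge_labels Q (st E X L B v r)"
proof -
  define I where "I i s \<longleftrightarrow> (\<exists>L' v'. s = st E X L' B v' r \<and> v' 0 = v 0 \<and> v' 1 = v 1 \<and> v' 2 = i \<and>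
    (\<forall>x<n. \<forall>y<n. L' x = L' y \<longleftrightarrow> (x, y) \<in> linked (first_arcs i) (- X)))" for i s
  have II: "I i (st E X L' B v' r)" if "v' 0 = v 0" "v' 1 = v 1" "v' 2 = i"
      "\<And>x y. x < n \<Longrightarrow> y < n \<Longrightarrow> L' x = L' y \<longleftrightarrow> (x, y) \<in> linked (first_arcs i) (- X)" for i L' v'
    unfolding I_def using that by blast
  show ?thesis unfolding merge_labels_def
  proof (rule wp_for_loop[where N = "n - 1" and I = I])
    fix i s
    assume i: "i < n - 1" and "I i s"
    then obtain L' v' where s: "s = st E X L' B v' r" "v' 0 = v 0" "v' 1 = v 1" "v' 2 = i"
      and L': "\<And>x y. x < n \<Longrightarrow> y < n \<Longrightarrow> L' x = L' y \<longleftrightarrow> (x, y) \<in> linked (first_arcs i) (- X)"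
      unfolding I_def by blast
    have i': "Suc i < n" using i by simp
    show "wp n (Cond (NLess ends_in_X (NLit 1)) (Seq (set_var 4 (label_of (end1 (var 2))))
        (Seq (set_var 5 (label_of (end2 (var 2)))) relabel)) Skip)
      (wp n (set_var 2 (NPlus (var 2) (NLit 1))) (I (Suc i))) s"
    proof (rule wp_Cond)
      assume "bval (NLess ends_in_X (NLit 1)) s"
      then have nX: "src i \<notin> X" "dst i \<notin> X" using s i' by (simp_all add: ends_in_X_def)
      let ?L = "\<lambda>x. if x < n \<and> L' x = L' (src i) then L' (dst i) else L' x"
      let ?R = "Restr (first_arcs i) (- X)"
      have "?L x = ?L y \<longleftrightarrow> (x, y) \<in> linked (first_arcs (Suc i)) (- X)" if "x < n" "y < n" for x y
      proof -
        have "Restr (first_arcs (Suc i)) (- X) = ?R \<union> {(src i, dst i), (dst i, src i)}"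
          using nX by (auto simp: first_arcs_Suc)
        moreover have "?R \<subseteq> {..<n} \<times> {..<n}" using first_arcs_sub[of i] i by auto
        ultimately show ?thesis
          using merged_labels_iff[of "{..<n}" L' ?R "src i" "dst i" x y] L' that i'
          unfolding linked_def by simp
      qed
      then have "I (Suc i) (st E X ?L B (v'(4 := L' (src i), 5 := L' (dst i), 3 := n, 2 := Suc i)) r)"
        using s(2,3) by (intro II) simp_all
      then show "wp n (Seq (set_var 4 (label_of (end1 (var 2)))) (Seq (set_var 5 (label_of (end2 (var 2)))) relabel))
        (wp n (set_var 2 (NPlus (var 2) (NLit 1))) (I (Suc i))) s"
        unfolding s(1) using s(4) i'
        by (intro wp_Seq, simp, intro wp_Seq, simp, intro wp_relabel, simp cong: if_cong)
    next
      assume "\<not> bval (NLess ends_in_X (NLit 1)) s"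
      then have "src i \<in> X \<or> dst i \<in> X"
        using s i' by (cases "src i \<in> X"; cases "dst i \<in> X") (simp_all add: ends_in_X_def)
      \<comment> \<open>An edge touching \<open>X\<close> disappears in the restriction to
        \<open>- X\<close>.\<close>
      then have "linked (first_arcs (Suc i)) (- X) = linked (first_arcs i) (- X)"
        unfolding linked_def by (intro arg_cong[of _ _ rtrancl]) (auto simp: first_arcs_Suc)
      then have "I (Suc i) (st E X L' B (v'(2 := Suc i)) r)"
        using s(2,3) L' by (intro II) simp_all
      then show "wp n Skip (wp n (set_var 2 (NPlus (var 2) (NLit 1))) (I (Suc i))) s"
        unfolding s(1) using s(4) by simp
    qed
  next
    have "I 0 (st E X L B (v(2 := 0)) r)"
      using L by (intro II) (simp_all add: linked_def first_arcs_0)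
    then show "wp n (set_var 2 (NLit 0)) (I 0) (st E X L B v r)" by simp
  next
    show "Q s" if "I (n - 1) s" for s
      using that Q unfolding I_def linked_first_arcs by blast
  next
    show "nval (var 2) s = i \<and> nval (NMinus (times_n 1) (NLit 1)) s = n - 1" if "I i s" for i s
    proof -
      from that obtain V v' r' L' where "s = st E V L' B v' r'" "v' 2 = i" unfolding I_def by blast
      then show ?thesis by simp
    qed
  qed simp
qed

lemma wp_sum_component:
  assumes "v 7 < n"
    and "Q (st E X L B (v(3 := n)) (r(2 := real (weight w {x. x < n \<and> L x = L (v 7)}))))"
  shows "wp n sum_component Q (st E X L B v r)"
proof -
  let ?W = "\<lambda>i. {x. x < i \<and> L x = L (v 7)}"
  have eq: "L i = L (v 7) \<Longrightarrow> ?W (Suc i) = insert i (?W i)"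
    "L i \<noteq> L (v 7) \<Longrightarrow> ?W (Suc i) = ?W i" for i
    by (auto simp: less_Suc_eq)
  have W: "L i = L (v 7) \<Longrightarrow> weight w (?W (Suc i)) = w i + weight w (?W i)"
    "L i \<noteq> L (v 7) \<Longrightarrow> weight w (?W (Suc i)) = weight w (?W i)" for i
    by (simp_all add: eq weight_insert)
  show ?thesis unfolding sum_component_def
    apply (rule wp_Seq, simp)
    apply (rule wp_for_loop[where N = n and
        I = "\<lambda>i s. s = st E X L B (v(3 := i)) (r(2 := real (weight w (?W i))))"])
        apply (simp add: weight_def)
       apply simp
      apply simp
     apply (simp, rule wp_Cond)
      apply (use assms W in \<open>simp_all add: add.commute\<close>)
    done
qed

text \<open>
  The maximum starts at the weight of \<open>X\<close>, so variable 6 keeps the value \<open>n\<close> exactly if \<open>X\<close> is safe.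
\<close>

lemma wp_select:
  fixes X :: "nat set" and L :: "nat \<Rightarrow> nat"
  defines "K \<equiv> \<lambda>b. {x. x < n \<and> L x = L b}"
  assumes Q: "\<And>v' r'. v' 0 = v 0 \<Longrightarrow> v' 1 = v 1 \<Longrightarrow> r' 0 = r 0 \<Longrightarrow> r' 3 = r 3 \<Longrightarrow>
      \<forall>b\<in>boundary A X. real (weight w (K b)) \<le> r' 1 \<Longrightarrow>
      v' 6 = n \<and> r' 1 = r 0 \<or> v' 6 \<in> boundary A X \<and> r' 1 = real (weight w (K (v' 6))) \<and> r 0 < r' 1 \<Longrightarrow>
      Q (st E X L B v' r')"
  shows "wp n select Q (st E X L B v r)"
proof -
  define I where "I i s \<longleftrightarrow> (\<exists>v' r'. s = st E X L B v' r' \<and> v' 0 = v 0 \<and> v' 1 = v 1 \<and> v' 2 = i \<and>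
      r' 0 = r 0 \<and> r' 3 = r 3 \<and> (\<forall>b\<in>boundary (first_arcs i) X. real (weight w (K b)) \<le> r' 1) \<and>
      (v' 6 = n \<and> r' 1 = r 0 \<or>
       v' 6 \<in> boundary (first_arcs i) X \<and> r' 1 = real (weight w (K (v' 6))) \<and> r 0 < r' 1))" for i s
  have II: "I i (st E X L B v' r')" if "v' 0 = v 0" "v' 1 = v 1" "v' 2 = i" "r' 0 = r 0" "r' 3 = r 3"
      "\<forall>b\<in>boundary (first_arcs i) X. real (weight w (K b)) \<le> r' 1"
      "v' 6 = n \<and> r' 1 = r 0 \<or> v' 6 \<in> boundary (first_arcs i) X \<and> r' 1 = real (weight w (K (v' 6))) \<and> r 0 < r' 1"
    for i v' r'
    unfolding I_def using that by blast
  have "wp n (for_loop 2 (NMinus (times_n 1) (NLit 1)) (Cond (num_eq ends_in_X (NLit 1)) try_edge Skip)) Q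
      (st E X L B (v(6 := n)) (r(1 := r 0)))"
  proof (rule wp_for_loop[where N = "n - 1" and I = I])
    fix i s
    assume i: "i < n - 1" and "I i s"
    then obtain v' r' where s: "s = st E X L B v' r'" "v' 0 = v 0" "v' 1 = v 1" "v' 2 = i" "r' 0 = r 0" "r' 3 = r 3"
      and le: "\<forall>b\<in>boundary (first_arcs i) X. real (weight w (K b)) \<le> r' 1"
      and best: "v' 6 = n \<and> r' 1 = r 0 \<or>
        v' 6 \<in> boundary (first_arcs i) X \<and> r' 1 = real (weight w (K (v' 6))) \<and> r 0 < r' 1"
      unfolding I_def by blast
    have i': "Suc i < n" using i by simp
    show "wp n (Cond (num_eq ends_in_X (NLit 1)) try_edge Skip)
      (wp n (set_var 2 (NPlus (var 2) (NLit 1))) (I (Suc i))) s"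
    proof (rule wp_Cond)
      assume "bval (num_eq ends_in_X (NLit 1)) s"
      then have one: "src i \<in> X \<longleftrightarrow> dst i \<notin> X"
        using s i' by (cases "src i \<in> X"; cases "dst i \<in> X") (simp_all add: ends_in_X_def)
      let ?c = "if src i \<in> X then dst i else src i"
      \<comment> \<open>An edge with exactly one end in \<open>X\<close> contributes its other end,
        \<open>?c\<close>, as a boundary vertex.\<close>
      have bd: "boundary (first_arcs (Suc i)) X = insert ?c (boundary (first_arcs i) X)"
        using one by (auto simp: first_arcs_Suc boundary_def)
      let ?v = "v'(7 := ?c, 3 := n)" and ?r = "r'(2 := real (weight w (K ?c)))"
      have new: "I (Suc i) (st E X L B (?v(6 := ?c, 2 := Suc i)) (?r(1 := real (weight w (K ?c)))))"
        if "r' 1 < real (weight w (K ?c))"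
        using s(2-6) that le best by (intro II) (auto simp: bd split del: if_split)
      have old: "I (Suc i) (st E X L B (?v(2 := Suc i)) ?r)" if "\<not> r' 1 < real (weight w (K ?c))"
        using s(2-6) that le best by (intro II) (auto simp: bd split del: if_split)
      have "wp n (Seq sum_component (Cond (RLess (rvar 1) (rvar 2)) (Seq (set_rvar 1 (rvar 2)) (set_var 6 (var 7))) Skip))
          (wp n (set_var 2 (NPlus (var 2) (NLit 1))) (I (Suc i))) (st E X L B (v'(7 := ?c)) r')"
        apply (rule wp_Seq, rule wp_sum_component)
        using i' apply simp
        apply (rule wp_Cond)
         apply (rule wp_Seq)
        using new old s(4)
         apply (simp_all add: K_def fun_upd_twist split del: if_split)
        done
      then show "wp n try_edge (wp n (set_var 2 (NPlus (var 2) (NLit 1))) (I (Suc i))) s"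
        unfolding try_edge_def s(1) using s(4) i'
        by (intro wp_Seq wp_Cond) (simp_all split: if_splits)
    next
      assume "\<not> bval (num_eq ends_in_X (NLit 1)) s"
      then have "src i \<in> X \<longleftrightarrow> dst i \<in> X"
        using s i' by (cases "src i \<in> X"; cases "dst i \<in> X") (simp_all add: ends_in_X_def)
      then have "boundary (first_arcs (Suc i)) X = boundary (first_arcs i) X"
        by (auto simp: first_arcs_Suc boundary_def)
      then have "I (Suc i) (st E X L B (v'(2 := Suc i)) r')"
        using s(2-6) le best by (intro II) simp_all
      then show "wp n Skip (wp n (set_var 2 (NPlus (var 2) (NLit 1))) (I (Suc i))) s"
        unfolding s(1) using s(4) by simp
    qed
  next
    have "I 0 (st E X L B (v(6 := n, 2 := 0)) (r(1 := r 0)))"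
      by (intro II) (simp_all add: boundary_def first_arcs_0)
    then show "wp n (set_var 2 (NLit 0)) (I 0) (st E X L B (v(6 := n)) (r(1 := r 0)))" by simp
  next
    show "Q s" if "I (n - 1) s" for s
      using that Q unfolding I_def boundary_first_arcs by blast
  next
    show "nval (var 2) s = i \<and> nval (NMinus (times_n 1) (NLit 1)) s = n - 1" if "I i s" for i s
    proof -
      from that obtain V v' r' L' where "s = st E V L' B v' r'" "v' 2 = i" unfolding I_def by blast
      then show ?thesis by simp
    qed
  qed simp
  then show ?thesis
    unfolding select_def by (intro wp_Seq, simp, intro wp_Seq, simp)
qed

lemma wp_grow_once:
  assumes X: "X \<subseteq> {..<n}" and r: "r 0 = real (weight w X)"
    and Q: "\<And>X' L' v' r'. X' = X \<and> safe w X \<or>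
        (\<exists>b\<in>boundary A X. X' = insert b X \<and> weight w X < weight w (outer X b) \<and>
          (\<forall>b'\<in>boundary A X. weight w (outer X b') \<le> weight w (outer X b))) \<Longrightarrow>
      v' 0 = v 0 \<Longrightarrow> v' 1 = v 1 \<Longrightarrow> r' 0 = real (weight w X') \<Longrightarrow> r' 3 = r 3 \<Longrightarrow> Q (st E X' L' B v' r')"
  shows "wp n grow_once Q (st E X L B v r)"
  unfolding grow_once_def
proof (rule wp_Seq, rule wp_init_labels, rule wp_Seq, rule wp_merge_labels)
  fix L' v' :: "nat \<Rightarrow> nat"
  assume L': "\<And>x y. x < n \<Longrightarrow> y < n \<Longrightarrow> L' x = L' y \<longleftrightarrow> (x, y) \<in> linked A ({..<n} - X)"
    and v': "v' 0 = (v(3 := n)) 0" "v' 1 = (v(3 := n)) 1"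
  \<comment> \<open>The label class of a boundary vertex is its component in the complement of
    \<open>X\<close>.\<close>
  have K: "{x. x < n \<and> L' x = L' b} = outer X b" if "b \<in> boundary A X" for b
  proof -
    have b: "b \<in> {..<n} - X" using boundary_V that by blast
    have "x < n \<and> L' x = L' b \<longleftrightarrow> (b, x) \<in> linked A ({..<n} - X)" for x
      using L'[of b x] b outer_sub[OF b] by fastforce
    then show ?thesis by auto
  qed
  show "wp n (Seq select add_selected) Q (st E X L' B v' r)"
  proof (rule wp_Seq, rule wp_select)
    fix v'' :: "nat \<Rightarrow> nat" and r' :: "nat \<Rightarrow> real"
    assume v'': "v'' 0 = v' 0" "v'' 1 = v' 1" and r': "r' 0 = r 0" "r' 3 = r 3"
      and le: "\<forall>b\<in>boundary A X. real (weight w {x. x < n \<and> L' x = L' b}) \<le> r' 1"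
      and best: "v'' 6 = n \<and> r' 1 = r 0 \<or> v'' 6 \<in> boundary A X \<and>
        r' 1 = real (weight w {x. x < n \<and> L' x = L' (v'' 6)}) \<and> r 0 < r' 1"
    have le': "\<forall>b\<in>boundary A X. real (weight w (outer X b)) \<le> r' 1" using le K by simp
    have v0: "v'' 0 = v 0" "v'' 1 = v 1" using v' v'' by simp_all
    show "wp n add_selected Q (st E X L' B v'' r')" unfolding add_selected_def
    proof (rule wp_Cond)
      assume "bval (NLess (var 6) (times_n 1)) (st E X L' B v'' r')"
      then have b: "v'' 6 \<in> boundary A X" "r' 1 = real (weight w (outer X (v'' 6)))" "r 0 < r' 1"
        using best K by auto
      have bX: "v'' 6 < n" "v'' 6 \<notin> X" using b(1) boundary_V by auto
      let ?b = "v'' 6"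
      have "Q (st E (insert ?b X) L' B v'' (r'(0 := r' 0 + real (w ?b))))"
      proof (rule Q)
        show "insert ?b X = X \<and> safe w X \<or>
          (\<exists>b\<in>boundary A X. insert ?b X = insert b X \<and> weight w X < weight w (outer X b) \<and>
            (\<forall>b'\<in>boundary A X. weight w (outer X b') \<le> weight w (outer X b)))"
          using b le' r by (intro disjI2 bexI[of _ ?b]) auto
        show "(r'(0 := r' 0 + real (w ?b))) 0 = real (weight w (insert ?b X))"
          using bX r r' X by (simp add: weight_insert finite_subset)
      qed (use v0 r' in simp_all)
      then show "wp n (Seq (set_X (var 6) 1) (set_rvar 0 (RPlus (rvar 0) (wt (var 6))))) Q (st E X L' B v'' r')"
        using bX by (intro wp_Seq) simp
    next
      assume "\<not> bval (NLess (var 6) (times_n 1)) (st E X L' B v'' r')"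
      \<comment> \<open>Nothing was selected, so the maximum is still the weight of \<open>X\<close>
        and bounds every component.\<close>
      then have "v'' 6 \<notin> boundary A X" using boundary_V by fastforce
      then have "safe w X" using best le' r by (auto simp: safe_def)
      then show "wp n Skip Q (st E X L' B v'' r')"
        using v0 r r' by (simp, intro Q) simp_all
    qed
  qed
qed auto

text \<open>Each round starting from an unsafe set adds a vertex, so after \<open>i\<close> rounds
  the set is safe or has more than \<open>i\<close> elements. For \<open>i = n\<close> the second
  alternative is impossible.\<close>

lemma wp_grow:
  assumes X: "greedy w m a X" and m: "\<And>x. x < n \<Longrightarrow> w x \<le> m" and r: "r 0 = real (weight w X)"
    and Q: "\<And>X' L' v' r'. greedy w m a X' \<Longrightarrow> safe w X' \<Longrightarrow> v' 0 = v 0 \<Longrightarrow>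
      r' 0 = real (weight w X') \<Longrightarrow> r' 3 = r 3 \<Longrightarrow> Q (st E X' L' B v' r')"
  shows "wp n grow Q (st E X L B v r)"
proof -
  define I where "I i s \<longleftrightarrow> (\<exists>X' L' v' r'. s = st E X' L' B v' r' \<and> greedy w m a X' \<and> v' 0 = v 0 \<and> v' 1 = i \<and>
    r' 0 = real (weight w X') \<and> r' 3 = r 3 \<and> (safe w X' \<or> i < card X'))" for i s
  have II: "I i (st E X' L' B v' r')" if "greedy w m a X'" "v' 0 = v 0" "v' 1 = i"
    "r' 0 = real (weight w X')" "r' 3 = r 3" "safe w X' \<or> i < card X'" for i X' L' v' r'
    unfolding I_def using that by blast
  show ?thesis unfolding grow_def
  proof (rule wp_for_loop[where N = n and I = I])
    have "finite X" "X \<noteq> {}" using X finite_subset by (auto simp: greedy_def)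
    then have "0 < card X" by (simp add: card_gt_0_iff)
    then have "I 0 (st E X L B (v(1 := 0)) r)" using X r by (intro II) simp_all
    then show "wp n (set_var 1 (NLit 0)) (I 0) (st E X L B v r)" by simp
  next
    fix i s
    assume "I i s"
    then obtain Y L' v' r' where s: "s = st E Y L' B v' r'" "v' 1 = i" and g: "greedy w m a Y"
      and rest: "v' 0 = v 0" "r' 0 = real (weight w Y)" "r' 3 = r 3" "safe w Y \<or> i < card Y"
      unfolding I_def by blast
    have Y: "Y \<subseteq> {..<n}" using g by (simp add: greedy_def)
    show "wp n grow_once (wp n (set_var 1 (NPlus (var 1) (NLit 1))) (I (Suc i))) s"
      unfolding s(1)
    proof (rule wp_grow_once[where r = r', OF Y rest(2)])
      fix Z and L'' v'' :: "nat \<Rightarrow> nat" and r'' :: "nat \<Rightarrow> real"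
      assume Z: "Z = Y \<and> safe w Y \<or> (\<exists>b\<in>boundary A Y. Z = insert b Y \<and> weight w Y < weight w (outer Y b) \<and>
          (\<forall>b'\<in>boundary A Y. weight w (outer Y b') \<le> weight w (outer Y b)))"
        and v'': "v'' 0 = v' 0" "v'' 1 = v' 1" and r'': "r'' 0 = real (weight w Z)" "r'' 3 = r' 3"
      have "greedy w m a Z \<and> (safe w Z \<or> Suc i < card Z)"
        using Z
      proof
        assume "Z = Y \<and> safe w Y"
        then show ?thesis using g by simp
      next
        assume "\<exists>b\<in>boundary A Y. Z = insert b Y \<and> weight w Y < weight w (outer Y b) \<and>
          (\<forall>b'\<in>boundary A Y. weight w (outer Y b') \<le> weight w (outer Y b))"
        then obtain b where b: "b \<in> boundary A Y" "Z = insert b Y" "weight w Y < weight w (outer Y b)"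
          "\<forall>b'\<in>boundary A Y. weight w (outer Y b') \<le> weight w (outer Y b)" by blast
        have "greedy w m a Z" unfolding b(2) using g m b(1,3,4) by (intro greedy_step) auto
        moreover have "\<not> safe w Y" using b(1,3) unfolding safe_def by (meson not_le)
        moreover have "card Z = Suc (card Y)"
          using b(1,2) boundary_V[of b Y] Y by (simp add: finite_subset)
        ultimately show ?thesis using rest(4) by simp
      qed
      then have "I (Suc i) (st E Z L'' B (v''(1 := Suc i)) r'')"
        using v'' r'' rest by (intro II) simp_all
      then show "wp n (set_var 1 (NPlus (var 1) (NLit 1))) (I (Suc i)) (st E Z L'' B v'' r'')"
        using v'' s(2) by simp
    qed
  next
    show "nval (var 1) s = i \<and> nval (times_n 1) s = n" if "I i s" for i s
    proof -
      from that obtain Y L' v' r' where "s = st E Y L' B v' r'" "v' 1 = i" unfolding I_def by blast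
      then show ?thesis by simp
    qed
  next
    fix s
    assume "I n s"
    then obtain Y L' v' r' where s: "s = st E Y L' B v' r'" and g: "greedy w m a Y"
      and rest: "v' 0 = v 0" "r' 0 = real (weight w Y)" "r' 3 = r 3" "safe w Y \<or> n < card Y"
      unfolding I_def by blast
    have "card Y \<le> card {..<n}" using g by (intro card_mono) (auto simp: greedy_def)
    then have "safe w Y" using rest(4) by simp
    then show "Q s" unfolding s using g rest by (intro Q)
  qed simp
qed

lemma wp_start:
  assumes "v 0 < n" "Q (st E {v 0} L B (v(3 := n)) (r(0 := real (w (v 0)))))"
  shows "wp n start Q (st E X L B v r)"
proof -
  have upd: "X - {..<i} - {i} = X - {..<Suc i}" for i by auto
  \<comment> \<open>\<open>nmem\<close> inspects only members of the set below \<open>n\<close>, so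
    what remains in \<open>X - {..<n}\<close> is invisible.\<close>
  have "nmem n E (insert (v 0) (X - {..<n})) L B (v(3 := n)) = nmem n E {v 0} L B (v(3 := n))"
    by (auto simp: nmem_def fun_eq_iff)
  then show ?thesis
    unfolding start_def using assms
    apply (intro wp_Seq)
    apply (rule wp_for_loop[where N = n and I = "\<lambda>i s. s = st E (X - {..<i}) L B (v(3 := i)) r"])
        apply (simp_all add: upd)
    apply (intro wp_Seq)
    apply simp
    done
qed

text \<open>The sets meeting \<open>{..<i}\<close> are those containing a start vertex already
  tried; for \<open>i = n\<close> these are all connected safe sets.\<close>

definition best_upto :: "nat \<Rightarrow> nat \<Rightarrow> nat set \<Rightarrow> bool" where
  "best_upto m i Y \<longleftrightarrow> conn_safe w Y \<and>
     (\<forall>S. conn_safe w S \<and> S \<inter> {..<i} \<noteq> {} \<longrightarrow> weight w Y \<le> weight w S + m)"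

text \<open>A set meeting \<open>{..<Suc i}\<close> contains \<open>i\<close>, where
  \<open>greedy_le\<close> bounds \<open>X\<close>, or an earlier vertex, where the old record is
  bounded. The lighter of the two satisfies both bounds.\<close>

lemma wp_record_best:
  assumes X: "greedy w m i X" "safe w X" "v 0 = i" "r 0 = real (weight w X)"
    and best: "0 < i \<Longrightarrow> best_upto m i {x. x < n \<and> B x \<noteq> 0} \<and> r 3 = real (weight w {x. x < n \<and> B x \<noteq> 0})"
    and Q: "\<And>B' v' r'. best_upto m (Suc i) {x. x < n \<and> B' x \<noteq> 0} \<Longrightarrow> v' 0 = v 0 \<Longrightarrow>
       r' 3 = real (weight w {x. x < n \<and> B' x \<noteq> 0}) \<Longrightarrow> Q (st E X L B' v' r')"
  shows "wp n record_best Q (st E X L B v r)"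
proof -
  have Xn: "X \<subseteq> {..<n}" using X by (simp add: greedy_def)
  have cX: "conn_safe w X" using X by (simp add: greedy_def conn_safe_def)
  have leX: "weight w X \<le> weight w S + m" if "conn_safe w S" "i \<in> S" for S
    using greedy_le[OF X(1)] that by blast
  let ?Y = "{x. x < n \<and> B x \<noteq> 0}"
  show ?thesis unfolding record_best_def
  proof (rule wp_Cond)
    assume "bval (BAnd (NLess (NLit 0) (var 0)) (BNot (RLess (rvar 0) (rvar 3)))) (st E X L B v r)"
    then have i: "0 < i" and "r 3 \<le> r 0" using X by auto
    then have le: "weight w ?Y \<le> weight w X" using best X by simp
    have "best_upto m (Suc i) ?Y"
      unfolding best_upto_def
    proof (intro conjI allI impI)
      show "conn_safe w ?Y" using best[OF i] by (simp add: best_upto_def)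
      fix S assume S: "conn_safe w S \<and> S \<inter> {..<Suc i} \<noteq> {}"
      show "weight w ?Y \<le> weight w S + m"
      proof (cases "i \<in> S")
        case True
        then show ?thesis using le leX[of S] S by simp
      next
        case False
        then have "S \<inter> {..<i} \<noteq> {}" using S by (auto simp: lessThan_Suc)
        then show ?thesis using best[OF i] S by (simp add: best_upto_def)
      qed
    qed
    then show "wp n Skip Q (st E X L B v r)" using best[OF i] by (simp, intro Q) auto
  next
    assume "\<not> bval (BAnd (NLess (NLit 0) (var 0)) (BNot (RLess (rvar 0) (rvar 3)))) (st E X L B v r)"
    then have less: "i = 0 \<or> weight w X < weight w ?Y" using best X by (cases "i = 0") auto
    have new: "best_upto m (Suc i) X"
      unfolding best_upto_def
    proof (intro conjI allI impI)
      show "conn_safe w X" by (rule cX)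
      fix S assume S: "conn_safe w S \<and> S \<inter> {..<Suc i} \<noteq> {}"
      show "weight w X \<le> weight w S + m"
      proof (cases "i \<in> S")
        case True
        then show ?thesis using leX[of S] S by simp
      next
        case False
        then have S': "S \<inter> {..<i} \<noteq> {}" using S by (auto simp: lessThan_Suc)
        then have i: "0 < i" by (cases i) auto
        then have "weight w ?Y \<le> weight w S + m" using best[OF i] S S' by (simp add: best_upto_def)
        then show ?thesis using less i by simp
      qed
    qed
    let ?B = "\<lambda>i x. if x < i then of_bool (x \<in> X) else B x"
    have upd: "(?B i)(i := of_bool (i \<in> X)) = ?B (Suc i)" for i by (auto simp: fun_eq_iff)
    have "{x. x < n \<and> ?B n x \<noteq> 0} = X" using Xn by auto
    then have "Q (st E X L (?B n) (v(3 := n)) (r(3 := r 0)))"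
      using new X by (intro Q) simp_all
    then show "wp n (Seq (set_rvar 3 (rvar 0)) (for_loop 3 (times_n 1) (set_B (var 3) (in_X (var 3))))) Q (st E X L B v r)"
      apply (intro wp_Seq)
      apply simp
      apply (rule wp_for_loop[where N = n and I = "\<lambda>i s. s = st E X L (?B i) (v(3 := i)) (r(3 := r 0))"])
          apply (simp_all add: upd)
      done
  qed
qed

lemma wp_search:
  assumes m: "\<And>x. x < n \<Longrightarrow> w x \<le> m"
    and Q: "\<And>X L B v r. best_upto m n {x. x < n \<and> B x \<noteq> 0} \<Longrightarrow> Q (st E X L B v r)"
  shows "wp n search Q (st E X L B v r)"
proof -
  define I where "I i s \<longleftrightarrow> (\<exists>X L B v r. s = st E X L B v r \<and> v 0 = i \<and>
    (0 < i \<longrightarrow> best_upto m i {x. x < n \<and> B x \<noteq> 0} \<and> r 3 = real (weight w {x. x < n \<and> B x \<noteq> 0})))" for i s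
  have II: "I i (st E X L B v r)" if "v 0 = i"
    "0 < i \<Longrightarrow> best_upto m i {x. x < n \<and> B x \<noteq> 0} \<and> r 3 = real (weight w {x. x < n \<and> B x \<noteq> 0})" for i X L B v r
    unfolding I_def using that by (intro exI conjI) (rule refl, simp_all)
  show ?thesis unfolding search_def
  proof (rule wp_for_loop[where N = n and I = I])
    show "wp n (set_var 0 (NLit 0)) (I 0) (st E X L B v r)" using II[of "v(0 := 0)" 0] by simp
  next
    fix i s
    assume i: "i < n" and "I i s"
    then obtain X L B v r where s: "s = st E X L B v r" "v 0 = i"
      and best: "0 < i \<Longrightarrow> best_upto m i {x. x < n \<and> B x \<noteq> 0} \<and> r 3 = real (weight w {x. x < n \<and> B x \<noteq> 0})"
      unfolding I_def by (elim exE conjE) (rule that, assumption+, simp)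
    show "wp n (Seq start (Seq grow record_best)) (wp n (set_var 0 (NPlus (var 0) (NLit 1))) (I (Suc i))) s"
      unfolding s(1)
    proof (rule wp_Seq, rule wp_start)
      show "v 0 < n" using i s by simp
      show "wp n (Seq grow record_best) (wp n (set_var 0 (NPlus (var 0) (NLit 1))) (I (Suc i)))
        (st E {v 0} L B (v(3 := n)) (r(0 := real (w (v 0)))))"
      proof (rule wp_Seq, rule wp_grow)
        show "greedy w m i {v 0}" using greedy_start[of i] i s(2) by simp
        show "w x \<le> m" if "x < n" for x using m that .
        show "(r(0 := real (w (v 0)))) 0 = real (weight w {v 0})" by (simp add: weight_def)
        fix X' and L' v' :: "nat \<Rightarrow> nat" and r' :: "nat \<Rightarrow> real"
        assume g: "greedy w m i X'" "safe w X'" "v' 0 = (v(3 := n)) 0" "r' 0 = real (weight w X')"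
          "r' 3 = (r(0 := real (w (v 0)))) 3"
        show "wp n record_best (wp n (set_var 0 (NPlus (var 0) (NLit 1))) (I (Suc i))) (st E X' L' B v' r')"
        proof (rule wp_record_best[where r = r', OF g(1,2) _ g(4)])
          show "v' 0 = i" using g s by simp
          show "best_upto m i {x. x < n \<and> B x \<noteq> 0} \<and> r' 3 = real (weight w {x. x < n \<and> B x \<noteq> 0})" if "0 < i"
            using g(5) best[OF that] by simp
          fix B' v'' :: "nat \<Rightarrow> nat" and r'' :: "nat \<Rightarrow> real"
          assume b: "best_upto m (Suc i) {x. x < n \<and> B' x \<noteq> 0}" "v'' 0 = v' 0"
            "r'' 3 = real (weight w {x. x < n \<and> B' x \<noteq> 0})"
          then have "I (Suc i) (st E X' L' B' (v''(0 := Suc i)) r'')"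
            by (intro II) simp_all
          then show "wp n (set_var 0 (NPlus (var 0) (NLit 1))) (I (Suc i)) (st E X' L' B' v'' r'')"
            using b(2) g(3) s(2) by simp
        qed
      qed
    qed
  next
    show "nval (var 0) s = i \<and> nval (times_n 1) s = n" if "I i s" for i s
    proof -
      from that obtain X L B v r where "s = st E X L B v r" "v 0 = i" unfolding I_def by blast
      then show ?thesis by simp
    qed
  next
    show "Q s" if "I n s" for s
      using that n_pos Q unfolding I_def by blast
  qed simp
qed

lemma wp_write_output:
  assumes "\<And>s. output_set n s = {x. x < n \<and> B x \<noteq> 0} \<Longrightarrow> Q s"
  shows "wp n write_output Q (st E X L B v r)"
proof -
  let ?E = "\<lambda>i x. if 0 < x \<and> x \<le> i then B x else E x"
  have upd: "(?E i)(Suc i := B (Suc i)) = ?E (Suc i)" for i by (auto simp: fun_eq_iff)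
  have E0: "(\<lambda>x. if 0 < x \<and> x = 0 then B x else E x) = E" by auto
  have "Q (st ((?E (n - 1))(0 := B 0)) X L B (v(3 := n - 1)) r)"
    using n_pos by (intro assms) (auto simp: output_set_def nmem_def)
  then show ?thesis
    unfolding write_output_def using n_pos
    apply (intro wp_Seq)
    apply (rule wp_for_loop[where N = "n - 1" and I = "\<lambda>i s. s = st (?E i) X L B (v(3 := i)) r"])
        apply (simp_all add: wp_set_E upd E0)
    done
qed

lemma wp_safe_set_program:
  assumes m: "\<And>x. x < n \<Longrightarrow> w x \<le> m"
  shows "wp n safe_set_program (\<lambda>s. best_upto m n (output_set n s)) (st E X L B v r)"
  unfolding safe_set_program_def
  by (rule wp_Seq, rule wp_search[OF m]) (simp_all add: wp_write_output)

end

section \<open>From encoded trees to the final bound\<close>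

context pair_graph begin

lemma connected_iff: "Digraph_Component.connected (with_proj G) \<longleftrightarrow> linked_set (parcs G) (pverts G)"
proof -
  have "with_proj G \<restriction> pverts G = with_proj G"
    using in_arcsD1 in_arcsD2 by (auto simp: induce_subgraph_def with_proj_def)
  then show ?thesis using connected_induce_subgraph_iff[of "pverts G"] by simp
qed

text \<open>\<open>unique_end\<close> is the contrapositive of \<open>two_arcs_cycle\<close>, with
  the second arc reversed.\<close>

lemma tree_rel_undirected_tree:
  assumes "undirected_tree (with_proj G)"
  shows "tree_rel (pverts G) (parcs G)"
proof
  show "finite (pverts G)" by (rule pair_finite_verts)
  show "sym (parcs G)" by (rule sym_parcs)
  show "parcs G \<subseteq> pverts G \<times> pverts G" using in_arcsD1 in_arcsD2 by auto
  show "irrefl (parcs G)" using pair_no_loops by (fastforce simp: irrefl_def)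
  show "linked_set (parcs G) (pverts G)" using assms by (simp add: undirected_tree_def connected_iff)
  fix X Y a a' b b'
  assume "X \<inter> Y = {}" "X \<subseteq> pverts G" "Y \<subseteq> pverts G" "linked_set (parcs G) X" "linked_set (parcs G) Y"
    "a \<in> X" "a' \<in> X" "b \<in> Y" "b' \<in> Y" "(a, b) \<in> parcs G" "(a', b') \<in> parcs G"
  then have "b \<noteq> b' \<Longrightarrow> \<exists>p. cycle p \<and> 3 \<le> length p"
    using arcs_symmetric by (intro two_arcs_cycle[of X Y a a' b b']) (auto simp: linked_set_def)
  then show "b = b'" using assms by (auto simp: undirected_tree_def)
qed

lemma conn_safe_iff:
  assumes "tree_rel (pverts G) (parcs G)"
  shows "tree_rel.conn_safe (pverts G) (parcs G) w S \<longleftrightarrow> connected_set G S \<and> w_safe G w S"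
proof -
  interpret t: tree_rel "pverts G" "parcs G" by fact
  have "t.safe w S \<longleftrightarrow> w_safe G w S" if "linked_set (parcs G) S" "S \<subseteq> pverts G"
    unfolding t.safe_def w_safe_iff[OF that] boundary_def by fastforce
  then show ?thesis unfolding t.conn_safe_def connected_set_iff by blast
qed

end

lemma length_concat_pairs: "length (concat (map (\<lambda>(u, v). [u, v]) es)) = 2 * length es"
  by (induction es) auto

lemma nth_concat_pairs:
  assumes "e < length es"
  shows "concat (map (\<lambda>(u, v). [u, v]) es) ! (2 * e) = fst (es ! e)"
    and "concat (map (\<lambda>(u, v). [u, v]) es) ! (2 * e + 1) = snd (es ! e)"
  using assms by (induction es arbitrary: e) (auto simp: less_Suc_eq_0_disj)

lemma card_edge_list:
  assumes "edge_list T es"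
  shows "card (parcs T) = 2 * length es"
proof -
  have "card (set es \<union> (set es)\<inverse>) = card (set es) + card ((set es)\<inverse>)"
    using assms by (intro card_Un_disjoint) (auto simp: edge_list_def)
  then show ?thesis using assms by (simp add: edge_list_def distinct_card)
qed

lemma safe_set_input_state:
  assumes tree: "tree_rel {..<n} (parcs T)" and es: "edge_list T es"
  defines "E \<equiv> load (n # concat (map (\<lambda>(u, v). [u, v]) es))"
  shows "safe_set_input n (parcs T) E (\<lambda>e. E (2 * e + 1)) (\<lambda>e. E (2 * e + 2))"
    and "input_state n es w \<epsilon> = (nmem n E {} (\<lambda>_. 0) (\<lambda>_. 0) (\<lambda>_. 0), rmem n \<epsilon> w (\<lambda>_. 0))"
proof -
  interpret tree_rel "{..<n}" "parcs T" by fact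
  have n: "0 < n" using linked_V by (auto simp: linked_set_def)
  \<comment> \<open>Each listed edge accounts for two arcs, so the input ends at cell
    \<open>2 * n - 2\<close> at the latest.\<close>
  have len: "length es < n" using card_arcs_le card_edge_list[OF es] n by simp
  have in_list: "E (2 * e + 1) = fst (es ! e)" "E (2 * e + 2) = snd (es ! e)" if "e < length es" for e
    using that nth_concat_pairs[OF that] by (simp_all add: E_def load_def length_concat_pairs)
  have beyond: "E i = 0" if "2 * length es < i" for i
    using that by (simp add: E_def load_def length_concat_pairs)
  show "safe_set_input n (parcs T) E (\<lambda>e. E (2 * e + 1)) (\<lambda>e. E (2 * e + 2))"
  proof
    show "E 0 = n" by (simp add: E_def load_def)
    fix e
    show "(E (2 * e + 1), E (2 * e + 2)) \<in> parcs T \<or> E (2 * e + 1) = E (2 * e + 2) \<and> E (2 * e + 1) < n"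
    proof (cases "e < length es")
      case True
      then show ?thesis using es nth_mem[OF True] by (simp only: in_list) (simp add: edge_list_def)
    next
      case False
      then show ?thesis using n by (simp add: beyond)
    qed
  next
    fix a b
    assume "(a, b) \<in> parcs T"
    then have "(a, b) \<in> set es \<or> (b, a) \<in> set es" using es by (auto simp: edge_list_def)
    then obtain e where e: "e < length es" "es ! e = (a, b) \<or> es ! e = (b, a)"
      by (auto simp: in_set_conv_nth)
    then have "Suc e < n" using len by simp
    moreover have "{(a, b), (b, a)} = {(E (2 * e + 1), E (2 * e + 2)), (E (2 * e + 2), E (2 * e + 1))}"
      using e unfolding in_list[OF e(1)] by auto
    ultimately show "\<exists>e. Suc e < n \<and>
        {(a, b), (b, a)} = {(E (2 * e + 1), E (2 * e + 2)), (E (2 * e + 2), E (2 * e + 1))}"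
      by blast
  qed (rule n refl)+
  have "load (\<epsilon> # map (\<lambda>v. real (w v)) [0..<n]) = rmem n \<epsilon> w (\<lambda>_. 0)"
    by (auto simp: load_def rmem_def fun_eq_iff nth_Cons split: nat.splits)
  moreover have "E = nmem n E {} (\<lambda>_. 0) (\<lambda>_. 0) (\<lambda>_. 0)"
    using len beyond by (auto simp: nmem_def fun_eq_iff)
  ultimately show "input_state n es w \<epsilon> = (nmem n E {} (\<lambda>_. 0) (\<lambda>_. 0) (\<lambda>_. 0), rmem n \<epsilon> w (\<lambda>_. 0))"
    by (simp add: input_state_def E_def)
qed

text \<open>The deepest nest has four loops: start vertices, rounds, edges, and vertices to relabel
  or sum. Five is the exponent of \<open>n\<close> in the claimed bound.\<close>

lemma loop_depth_safe_set_program: "loop_depth safe_set_program \<le> 5"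
  by (simp add: safe_set_program_def search_def start_def grow_def grow_once_def record_best_def
      init_labels_def merge_labels_def relabel_def select_def try_edge_def sum_component_def
      add_selected_def write_output_def for_loop_def set_var_def set_X_def set_label_def set_B_def set_rvar_def)

text \<open>For \<open>\<epsilon> \<le> 1\<close> both the numerator factor and the reciprocal of
  \<open>\<epsilon> ^ 8\<close> are at least 1. The constant 32 comes from
  \<open>n + 1 \<le> 2 * n\<close>, raised to the fifth power.\<close>

lemma real_time_bound_le:
  fixes \<epsilon> :: real
  assumes "0 < n" "0 < \<epsilon>" "\<epsilon> \<le> 1" and depth: "loop_depth P \<le> 5"
  shows "real (time_bound n P) \<le> real (32 * csize P) * ((1 + 3 * \<epsilon> + real M) ^ 4 * real n ^ 5 / \<epsilon> ^ 8)"
proof -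
  have "time_bound n P \<le> csize P * (n + 1) ^ 5" by (rule time_bound_le[OF depth])
  also have "\<dots> \<le> csize P * (2 * n) ^ 5" using assms(1) by (intro mult_le_mono power_mono) auto
  finally have "real (time_bound n P) \<le> real (csize P * (2 * n) ^ 5)" by (simp only: of_nat_le_iff)
  also have "\<dots> = real (32 * csize P) * real n ^ 5" by (simp add: power_mult_distrib)
  also have "\<dots> \<le> real (32 * csize P) * ((1 + 3 * \<epsilon> + real M) ^ 4 * real n ^ 5 / \<epsilon> ^ 8)"
  proof (rule mult_left_mono)
    have "\<epsilon> ^ 8 \<le> 1" using assms by (intro power_le_one) auto
    moreover have "1 \<le> (1 + 3 * \<epsilon> + real M) ^ 4" using assms by (intro one_le_power) auto
    ultimately have "\<epsilon> ^ 8 * real n ^ 5 \<le> (1 + 3 * \<epsilon> + real M) ^ 4 * real n ^ 5"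
      by (intro mult_right_mono) auto
    then show "real n ^ 5 \<le> (1 + 3 * \<epsilon> + real M) ^ 4 * real n ^ 5 / \<epsilon> ^ 8"
      using assms by (simp add: pos_le_divide_eq mult.commute)
  qed simp
  finally show ?thesis .
qed

lemma safe_set_program_correct:
  fixes T :: "nat pair_pre_digraph"
  assumes tree: "undirected_tree (with_proj T)" and V: "pverts T = {..<n}" and es: "edge_list T es"
  obtains t s where "exec safe_set_program (input_state n es w \<epsilon>) t s" "t \<le> time_bound n safe_set_program"
    "connected_set (with_proj T) (output_set n s)" "w_safe (with_proj T) w (output_set n s)"
    "weight w (output_set n s) \<le> cs (with_proj T) w + Max (w ` pverts T)" "0 < n"
proof -
  interpret T: pair_graph T using tree by (auto simp: undirected_tree_def intro: pair_graphI_graph)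
  have t: "tree_rel (pverts T) (parcs T)" by (rule T.tree_rel_undirected_tree[OF tree])
  let ?E = "load (n # concat (map (\<lambda>(u, v). [u, v]) es))"
  interpret safe_set_input n "parcs T" \<epsilon> w ?E "\<lambda>e. ?E (2 * e + 1)" "\<lambda>e. ?E (2 * e + 2)"
    using safe_set_input_state(1) t es V by simp
  note cs_iff = T.conn_safe_iff[OF t, unfolded V]
  let ?m = "Max (w ` pverts T)"
  have "wp n safe_set_program (\<lambda>s. best_upto ?m n (output_set n s)) (input_state n es w \<epsilon>)"
    using wp_safe_set_program[of ?m] safe_set_input_state(2)[OF _ es, of n w \<epsilon>] t V by simp
  then obtain t s where ts: "exec safe_set_program (input_state n es w \<epsilon>) t s"
      "t \<le> time_bound n safe_set_program" "best_upto ?m n (output_set n s)"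
    unfolding wp_def by blast
  let ?Y = "output_set n s"
  let ?W = "{weight w S |S. connected_set (with_proj T) S \<and> w_safe (with_proj T) w S}"
  have Y: "conn_safe w ?Y" using ts(3) by (simp add: best_upto_def)
  have "?W \<subseteq> weight w ` Pow {..<n}" using V by (auto simp: connected_set_def)
  then have "finite ?W" by (rule finite_subset) simp
  \<comment> \<open>The computed set itself witnesses that a connected safe set exists, so the
    minimum is attained by some \<open>S\<close>.\<close>
  moreover have "?W \<noteq> {}" using Y cs_iff by auto
  ultimately have "cs (with_proj T) w \<in> ?W" unfolding cs_def by (rule Min_in)
  then obtain S where S: "cs (with_proj T) w = weight w S" "conn_safe w S" using cs_iff by auto
  \<comment> \<open>Connected sets are nonempty, so some start vertex lies in the optimal
    set.\<close>
  then have "S \<inter> {..<n} \<noteq> {}" by (auto simp: conn_safe_def linked_set_def)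
  then have "weight w ?Y \<le> cs (with_proj T) w + ?m" using ts(3) S by (simp add: best_upto_def)
  then show thesis using that ts Y cs_iff n_pos by blast
qed

theorem theorem3:
  shows "\<exists>c::real. \<forall>M::nat. 0 < M \<longrightarrow>
    (\<exists>P::com. \<forall>(T::nat pair_pre_digraph) (n::nat) (es::(nat \<times> nat) list) (w::nat \<Rightarrow> nat) (\<epsilon>::real).
       undirected_tree (with_proj T) \<and> pverts T = {..<n} \<and> edge_list T es \<and>
       0 < \<epsilon> \<and> \<epsilon> \<le> min (1 / 3) (1 / real M) \<and>
       Max (w ` pverts T) \<le> M * Min (w ` pverts T) \<longrightarrow>
       (\<exists>t s S. exec P (input_state n es w \<epsilon>) t s \<and> S = output_set n s \<and>
          connected_set (with_proj T) S \<and> w_safe (with_proj T) w S \<and>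
          real (weight w S)
            \<le> (1 + 3 * \<epsilon> + 2 * \<epsilon>\<^sup>2) * real (cs (with_proj T) w) + real (Max (w ` pverts T)) \<and>
          real t \<le> c * ((1 + 3 * \<epsilon> + real M) ^ 4 * real n ^ 5 / \<epsilon> ^ 8)))"
\<comment> \<open>One program serves all \<open>M\<close>, and the constant depends on its size
  alone.\<close>
proof (intro exI[of _ "real (32 * csize safe_set_program)"] allI impI exI[of _ safe_set_program])
  fix M n :: nat and T :: "nat pair_pre_digraph" and es and w :: "nat \<Rightarrow> nat" and \<epsilon> :: real
  assume A: "undirected_tree (with_proj T) \<and> pverts T = {..<n} \<and> edge_list T es \<and>
       0 < \<epsilon> \<and> \<epsilon> \<le> min (1 / 3) (1 / real M) \<and> Max (w ` pverts T) \<le> M * Min (w ` pverts T)"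
  then obtain t s where ts: "exec safe_set_program (input_state n es w \<epsilon>) t s" "t \<le> time_bound n safe_set_program"
    "connected_set (with_proj T) (output_set n s)" "w_safe (with_proj T) w (output_set n s)"
    "weight w (output_set n s) \<le> cs (with_proj T) w + Max (w ` pverts T)" "0 < n"
    using safe_set_program_correct by metis
  let ?c = "real (cs (with_proj T) w)"
  have "real (weight w (output_set n s)) \<le> ?c + real (Max (w ` pverts T))"
    using ts(5) by linarith
  \<comment> \<open>The program attains factor 1 on the optimum, and the factor allowed is at least
    1.\<close>
  moreover have "1 * ?c \<le> (1 + 3 * \<epsilon> + 2 * \<epsilon>\<^sup>2) * ?c"
    using A by (intro mult_right_mono) auto
  ultimately have w: "real (weight w (output_set n s)) \<le> (1 + 3 * \<epsilon> + 2 * \<epsilon>\<^sup>2) * ?c + real (Max (w ` pverts T))"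
    by linarith
  have "real (time_bound n safe_set_program)
      \<le> real (32 * csize safe_set_program) * ((1 + 3 * \<epsilon> + real M) ^ 4 * real n ^ 5 / \<epsilon> ^ 8)"
    using A ts(6) by (intro real_time_bound_le loop_depth_safe_set_program) auto
  then have "real t \<le> real (32 * csize safe_set_program) * ((1 + 3 * \<epsilon> + real M) ^ 4 * real n ^ 5 / \<epsilon> ^ 8)"
    using ts(2) by linarith
  then show "\<exists>t s S. exec safe_set_program (input_state n es w \<epsilon>) t s \<and> S = output_set n s \<and>
          connected_set (with_proj T) S \<and> w_safe (with_proj T) w S \<and>
          real (weight w S)
            \<le> (1 + 3 * \<epsilon> + 2 * \<epsilon>\<^sup>2) * real (cs (with_proj T) w) + real (Max (w ` pverts T)) \<and>
          real t \<le> real (32 * csize safe_set_program) * ((1 + 3 * \<epsilon> + real M) ^ 4 * real n ^ 5 / \<epsilon> ^ 8)"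
    using ts(1,3,4) w by blast
qed

end
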